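(* Let $(p_n,q_n)_{n\ge 0}$ be any sequence of pairs of real numbers with $0\le p_n,q_n\le 1$, and let $\mu$ be the Borel probability measure on $\mathbb K=\{0,1\}^{\mathbb N}$ defined by the non-homogeneous Markov rule described in the context. Then $$\dim_*(\mu)=\dim^*(\mu)=h_*(\mu)\qquad\text{and}\qquad \mathrm{Dim}_*(\mu)=\mathrm{Dim}^*(\mu)=h^*(\mu).$$
   Context: $\mathbb K=\{0,1\}^{\mathbb N}$ is the dyadic Cantor set (limit set of the dyadic tree) with the metric in which the cylinder $I_{\epsilon_1\dots\epsilon_n}=\{x\in\mathbb K: x_1=\epsilon_1,\dots,x_n=\epsilon_n\}$ ($\epsilon_i\in\{0,1\}$) has diameter $2^{-n}$. $\mathcal F_n$ denotes the set of cylinders of generation $n$ ($\mathcal F_0=\{\mathbb K\}$). For $x\in\mathbb K$, $I_n(x)$ is the cylinder of $\mathcal F_n$ containing $x$. The measure $\mu$: $\mu(I_0)=p_0$, $\mu(I_1)=1-p_0$, and for $n\ge1$, every $I=I_{\epsilon_1\dots\epsilon_n}$ and $\epsilon_{n+1}\in\{0,1\}$, writing $IJ=I_{\epsilon_1\dots\epsilon_n\epsilon_{n+1}}$, $$\mu(IJ)=\mu(I)\cdot\begin{cases} p_n\mathbf 1_{\{\epsilon_{n+1}=0\}}+(1-p_n)\mathbf 1_{\{\epsilon_{n+1}=1\}} & \text{if } \epsilon_n=0,\\ q_n\mathbf 1_{\{\epsilon_{n+1}=0\}}+(1-q_n)\mathbf 1_{\{\epsilon_{n+1}=1\}} & \text{if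 } \epsilon_n=1.\end{cases}$$ Entropies (with convention $0\log 0=0$): $h_*(\mu)=\liminf_{n\to\infty}\frac{-1}{n\log 2}\sum_{I\in\mathcal F_n}\mu(I)\log\mu(I)$ and $h^*(\mu)=\limsup_{n\to\infty}\frac{-1}{n\log 2}\sum_{I\in\mathcal F_n}\mu(I)\log\mu(I)$. Dimensions of the measure: $\dim_*(\mu)=\inf\{\dim_{\mathcal H}E: E\subset\mathbb K,\ \mu(E)>0\}$, $\dim^*(\mu)=\inf\{\dim_{\mathcal H}E: E\subset\mathbb K,\ \mu(\mathbb K\setminus E)=0\}$, $\mathrm{Dim}_*(\mu)=\inf\{\dim_{\mathcal P}E: \mu(E)>0\}$, $\mathrm{Dim}^*(\mu)=\inf\{\dim_{\mathcal P}E:\mu(\mathbb K\setminus E)=0\}$, where $\dim_{\mathcal H}$ is Hausdorff dimension and $\dim_{\mathcal P}$ is packing (Tricot) dimension. *)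

theory Defs
  imports "HOL-Probability.Probability"
begin

text \<open>Points of the dyadic Cantor set K = {0,1}^N are functions nat => bool;
  the coordinate x_(i+1) of the paper is x i, and False encodes 0, True encodes 1.\<close>

type_synonym cpt = "nat \<Rightarrow> bool"

text \<open>Ultrametric: two points first differing at (0-based) index k share the
  cylinder of generation k, so their distance is 2^(-k).\<close>
definition cdist :: "cpt \<Rightarrow> cpt \<Rightarrow> real" where
  "cdist x y = (if x = y then 0 else (1/2) ^ (LEAST k. x k \<noteq> y k))"

definition cdiam :: "cpt set \<Rightarrow> real" where
  "cdiam U = (if U = {} then 0 else Sup {cdist x y | x y. x \<in> U \<and> y \<in> U})"

definition ccball :: "cpt \<Rightarrow> real \<Rightarrow> cpt set" where
  "ccball x r = {y. cdist x y \<le> r}"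

definition cyl :: "nat \<Rightarrow> cpt \<Rightarrow> cpt set" where
  "cyl n x = {y. \<forall>i<n. y i = x i}"

definition gen :: "nat \<Rightarrow> cpt set set" where
  "gen n = {cyl n x | x. True}"

definition hausdorff_pre :: "real \<Rightarrow> real \<Rightarrow> cpt set \<Rightarrow> ennreal" where
  "hausdorff_pre s \<delta> E = Inf {(\<Sum>i. ennreal (cdiam (U i) powr s)) | U.
      E \<subseteq> (\<Union>i. U i) \<and> (\<forall>i. cdiam (U i) \<le> \<delta>)}"

definition hausdorff_measure :: "real \<Rightarrow> cpt set \<Rightarrow> ennreal" where
  "hausdorff_measure s E = (SUP \<delta>\<in>{0<..}. hausdorff_pre s \<delta> E)"

definition hdim :: "cpt set \<Rightarrow> ereal" where
  "hdim E = Inf {ereal s | s. 0 \<le> s \<and> hausdorff_measure s E = 0}"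

definition packing_pre :: "real \<Rightarrow> real \<Rightarrow> cpt set \<Rightarrow> ennreal" where
  "packing_pre s \<delta> E = Sup {(\<Sum>(x,r)\<in>P. ennreal ((2*r) powr s)) | P.
      finite P \<and> (\<forall>(x,r)\<in>P. x \<in> E \<and> 0 < r \<and> r \<le> \<delta>) \<and>
      (\<forall>a\<in>P. \<forall>b\<in>P. a \<noteq> b \<longrightarrow> ccball (fst a) (snd a) \<inter> ccball (fst b) (snd b) = {})}"

definition packing_pre0 :: "real \<Rightarrow> cpt set \<Rightarrow> ennreal" where
  "packing_pre0 s E = (INF \<delta>\<in>{0<..}. packing_pre s \<delta> E)"

definition packing_measure :: "real \<Rightarrow> cpt set \<Rightarrow> ennreal" where
  "packing_measure s E = Inf {(\<Sum>i. packing_pre0 s (U i)) | U. E \<subseteq> (\<Union>i. U i)}"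

definition pdim :: "cpt set \<Rightarrow> ereal" where
  "pdim E = Inf {ereal s | s. 0 \<le> s \<and> packing_measure s E = 0}"

definition mfactor :: "(nat \<Rightarrow> real) \<Rightarrow> (nat \<Rightarrow> real) \<Rightarrow> cpt \<Rightarrow> nat \<Rightarrow> real" where
  "mfactor p q x i =
     (if i = 0 then (if \<not> x 0 then p 0 else 1 - p 0)
      else if \<not> x (i - 1) then (if \<not> x i then p i else 1 - p i)
      else (if \<not> x i then q i else 1 - q i))"

definition xlogx :: "real \<Rightarrow> real" where
  "xlogx t = (if t = 0 then 0 else t * ln t)"

definition entropy_n :: "cpt measure \<Rightarrow> nat \<Rightarrow> real" where
  "entropy_n \<mu> n = - (\<Sum>I\<in>gen n. xlogx (measure \<mu> I))"

definition h_lower :: "cpt measure \<Rightarrow> ereal" where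
  "h_lower \<mu> = liminf (\<lambda>n. ereal (entropy_n \<mu> n / (real n * ln 2)))"

definition h_upper :: "cpt measure \<Rightarrow> ereal" where
  "h_upper \<mu> = limsup (\<lambda>n. ereal (entropy_n \<mu> n / (real n * ln 2)))"

definition dim_lower :: "cpt measure \<Rightarrow> ereal" where
  "dim_lower \<mu> = Inf {hdim E | E. E \<in> sets \<mu> \<and> emeasure \<mu> E > 0}"

definition dim_upper :: "cpt measure \<Rightarrow> ereal" where
  "dim_upper \<mu> = Inf {hdim E | E. E \<in> sets \<mu> \<and> emeasure \<mu> (UNIV - E) = 0}"

definition Dim_lower :: "cpt measure \<Rightarrow> ereal" where
  "Dim_lower \<mu> = Inf {pdim E | E. E \<in> sets \<mu> \<and> emeasure \<mu> E > 0}"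

definition Dim_upper :: "cpt measure \<Rightarrow> ereal" where
  "Dim_upper \<mu> = Inf {pdim E | E. E \<in> sets \<mu> \<and> emeasure \<mu> (UNIV - E) = 0}"

end

theory Submission
  imports Defs "HOL-Real_Asymp.Real_Asymp"
begin

text \<open>
  Let \<open>I\<^sub>n(x) = - ln \<mu>(cyl n x)\<close>, whose mean is the entropy \<open>e\<^sub>n\<close> of generation \<open>n\<close>. The claim
  reduces to \<open>(I\<^sub>n - e\<^sub>n) / n \<longlonglongrightarrow> 0\<close> almost surely: the mass distribution principle for Hausdorff
  and packing measures then turns \<open>liminf\<close> and \<open>limsup\<close> of the local dimension into the dimensions.

  For the law of large numbers, let \<open>m\<^sub>n\<close> be the mean of \<open>I\<^sub>n - e\<^sub>n\<close> over the points whose \<open>n\<close>-th letter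
  is 0. One Markov step gives \<open>\<bar>m\<^bsub>n+1\<^esub>\<bar> \<le> \<bar>p\<^sub>n - q\<^sub>n\<bar> \<bar>m\<^sub>n\<bar> + 1\<close>, while the variance grows by at most
  \<open>2 \<bar>m\<^sub>n\<bar> \<bar>H(p\<^sub>n) - H(q\<^sub>n)\<bar> + O(1)\<close> with \<open>H\<close> the binary entropy. The point is that
  \<open>\<bar>H(p) - H(q)\<bar> \<le> 4 sqrt (1 - \<bar>p - q\<bar>)\<close>: a step that transports correlations well carries little entropy.
  Hence the variance of \<open>I\<^sub>n\<close> is \<open>O(n\<^bsup>3/2\<^esup>)\<close>, the second moments of \<open>(I\<^sub>n - e\<^sub>n) / n\<close> are summable along
  \<open>n = k\<^sup>4\<close>, and monotonicity of \<open>I\<^sub>n\<close> and \<open>e\<^sub>n\<close> fills the gaps.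
\<close>

section \<open>Cylinders and the ultrametric\<close>

lemma cyl_eq: "y \<in> cyl n x \<Longrightarrow> cyl n y = cyl n x"
  by (auto simp: cyl_def)

lemma self_mem_cyl [simp]: "x \<in> cyl n x"
  by (simp add: cyl_def)

lemma cyl_0 [simp]: "cyl 0 x = UNIV"
  by (simp add: cyl_def)

lemma half_power_le_iff: "(1/2 :: real) ^ m \<le> (1/2) ^ n \<longleftrightarrow> n \<le> m"
  by (rule power_decreasing_iff) auto

text \<open>\<open>L\<close> is the first disagreement, and \<open>n \<le> L\<close> says that the
  first \<open>n\<close> letters agree. So closed balls of radius 2^-n are exactly the cylinders of
  generation \<open>n\<close>.\<close>

lemma cdist_le_power_iff: "cdist x y \<le> (1/2) ^ n \<longleftrightarrow> y \<in> cyl n x"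
proof (cases "x = y")
  case True
  then show ?thesis by (simp add: cdist_def)
next
  case False
  define L where "L = (LEAST k. x k \<noteq> y k)"
  obtain k where "x k \<noteq> y k" using False by auto
  then have L: "x L \<noteq> y L" unfolding L_def by (rule LeastI)
  have less: "y i = x i" if "i < L" for i
    using not_less_Least[OF that[unfolded L_def]] by simp
  have "(1/2::real) ^ L \<le> (1/2) ^ n \<longleftrightarrow> n \<le> L"
    by (rule half_power_le_iff)
  also have "\<dots> \<longleftrightarrow> y \<in> cyl n x"
  proof
    assume "n \<le> L"
    then show "y \<in> cyl n x" using less unfolding cyl_def by simp
  next
    assume "y \<in> cyl n x"
    then have "\<not> L < n" using L unfolding cyl_def by auto
    then show "n \<le> L" by simp
  qed
  finally show ?thesis using False by (simp add: cdist_def L_def)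
qed

lemma cdist_le_1: "cdist x y \<le> 1"
  using cdist_le_power_iff[of x y 0] by simp

lemma cdist_le_0D: "cdist x y \<le> 0 \<Longrightarrow> x = y"
proof (rule ccontr)
  assume "cdist x y \<le> 0" "x \<noteq> y"
  moreover then have "0 < cdist x y" by (simp add: cdist_def)
  ultimately show False by simp
qed

lemma cdist_values:
  obtains "x = y" "cdist x y = 0" | n where "x \<noteq> y" "cdist x y = (1/2) ^ n"
  by (auto simp: cdist_def)

lemma ccball_power: "ccball x ((1/2) ^ n) = cyl n x"
  by (simp add: ccball_def cdist_le_power_iff)

lemma half_power_le_obtain:
  fixes d :: real assumes "0 < d" obtains N where "(1/2) ^ N \<le> d"
  using real_arch_pow_inv[OF assms, of "1/2"] by (auto intro: less_imp_le)

text \<open>Nonzero distances are powers of 1/2, so every closed ball of positive radius is a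
  cylinder; its generation is the first \<open>n\<close> with 2^-n at most \<open>r\<close>. The
  reverse bound asks for \<open>r \<le> 1\<close> because at \<open>n = 0\<close> the radius may be
  arbitrarily large.\<close>

lemma radius_to_generation:
  assumes "0 < r"
  obtains n where "(1/2) ^ n \<le> r" "\<And>x y. cdist x y \<le> r \<longleftrightarrow> y \<in> cyl n x"
    "r \<le> 1 \<Longrightarrow> r \<le> 2 * (1/2) ^ n"
proof -
  define n where "n = (LEAST n. (1/2) ^ n \<le> r)"
  obtain N where "(1/2) ^ N \<le> r"
    using half_power_le_obtain[OF assms] .
  then have n: "(1/2) ^ n \<le> r"
    unfolding n_def by (rule LeastI)
  have least: "n \<le> m" if "(1/2) ^ m \<le> r" for m
    unfolding n_def using that by (rule Least_le)
  have iff: "cdist x y \<le> r \<longleftrightarrow> y \<in> cyl n x" for x y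
  proof -
    have "cdist x y \<le> r \<longleftrightarrow> cdist x y \<le> (1/2) ^ n"
    proof
      assume le: "cdist x y \<le> r"
      show "cdist x y \<le> (1/2) ^ n"
      proof (rule cdist_values[of x y])
        fix m assume m: "cdist x y = (1/2) ^ m"
        with le have "n \<le> m" using least by simp
        then show ?thesis unfolding m by (intro power_decreasing) auto
      qed simp
    qed (use n in simp)
    then show ?thesis by (simp add: cdist_le_power_iff)
  qed
  have "r \<le> 2 * (1/2) ^ n" if "r \<le> 1"
  proof (cases n)
    case 0
    then show ?thesis using that by simp
  next
    case (Suc m)
    then have "\<not> (1/2) ^ m \<le> r" using least[of m] by auto
    then show ?thesis using Suc by simp
  qed
  with n iff show thesis using that by blast
qed

lemma cdiam_bdd: "bdd_above {cdist x y | x y. x \<in> U \<and> y \<in> U}"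
  by (rule bdd_aboveI[of _ 1]) (use cdist_le_1 in auto)

lemma cdist_le_cdiam: "x \<in> U \<Longrightarrow> y \<in> U \<Longrightarrow> cdist x y \<le> cdiam U"
  unfolding cdiam_def by (auto intro!: cSup_upper cdiam_bdd)

lemma cdiam_nonneg: "0 \<le> cdiam U"
proof (cases "U = {}")
  case False
  then obtain x where "x \<in> U" by auto
  from cdist_le_cdiam[OF this this] show ?thesis by (simp add: cdist_def)
qed (simp add: cdiam_def)

lemma cdiam_cyl_le: "cdiam (cyl n x) \<le> (1/2) ^ n"
proof -
  let ?D = "{cdist y z | y z. y \<in> cyl n x \<and> z \<in> cyl n x}"
  have ne: "cyl n x \<noteq> {}" using self_mem_cyl[of x n] by blast
  have "cdist x x \<in> ?D" using self_mem_cyl[of x n] by blast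
  then have "?D \<noteq> {}" by blast
  moreover have "d \<le> (1/2) ^ n" if "d \<in> ?D" for d
    using that by (clarsimp simp: cdist_le_power_iff cyl_eq)
  ultimately have "Sup ?D \<le> (1/2) ^ n"
    by (rule cSup_least)
  then show ?thesis unfolding cdiam_def if_not_P[OF ne] .
qed

lemma half_power_powr: "((1/2) ^ n) powr s = 2 powr (- (real n * s))"
proof -
  have "(1/2::real) ^ n = 2 powr (- real n)"
    by (simp add: powr_minus powr_realpow power_divide field_simps)
  then show ?thesis by (simp add: powr_powr)
qed

text \<open>Canonical representatives of the cylinders of generation \<open>n\<close>.\<close>
definition words :: "nat \<Rightarrow> cpt set" where
  "words n = {x. \<forall>i\<ge>n. \<not> x i}"

lemma words_0: "words 0 = {\<lambda>_. False}"
  by (auto simp: words_def)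

lemma words_Suc: "words (Suc n) = words n \<union> (\<lambda>x. x(n := True)) ` words n"
proof (intro equalityI subsetI)
  fix x assume x: "x \<in> words (Suc n)"
  show "x \<in> words n \<union> (\<lambda>x. x(n := True)) ` words n"
  proof (cases "x n")
    case True
    then have "x = (x(n := False))(n := True)" by (simp add: fun_upd_idem)
    moreover have "x(n := False) \<in> words n" using x by (auto simp: words_def)
    ultimately show ?thesis by blast
  next
    case False
    then show ?thesis using x by (auto simp: words_def le_Suc_eq dest: Suc_leI le_neq_implies_less)
  qed
qed (auto simp: words_def)

lemma finite_words: "finite (words n)"
  by (induction n) (auto simp: words_0 words_Suc)

lemma truncate_mem_words: "(\<lambda>i. i < n \<and> x i) \<in> words n"
  by (simp add: words_def)

lemma truncate_mem_cyl: "x \<in> cyl n (\<lambda>i. i < n \<and> x i)" "(\<lambda>i. i < n \<and> x i) \<in> cyl n x"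
  by (auto simp: cyl_def)

lemma mem_words_cyl_eq:
  assumes "x \<in> words n" "y \<in> words n" "x \<in> cyl n y" shows "x = y"
proof
  fix i show "x i = y i" using assms by (cases "i < n") (auto simp: words_def cyl_def)
qed

lemma inj_on_cyl_words: "inj_on (cyl n) (words n)"
  by (metis inj_onI mem_words_cyl_eq self_mem_cyl)

lemma gen_eq_words: "gen n = cyl n ` words n"
proof -
  have "cyl n x \<in> cyl n ` words n" for x
    using cyl_eq[OF truncate_mem_cyl(1)] truncate_mem_words by blast
  then show ?thesis by (auto simp: gen_def)
qed

section \<open>Local dimensions bound Hausdorff and packing measures\<close>

locale cantor_prob_space = prob_space M for M :: "cpt measure" +
  assumes space_UNIV [simp]: "space M = UNIV"
    and cyl_sets [measurable, simp]: "cyl n x \<in> sets M"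
begin

text \<open>Since \<open>y \<in> cyl n x\<close> is symmetric in \<open>x\<close> and
  \<open>y\<close>, the hypothesis makes \<open>P\<close> depend on the first \<open>n\<close>
  letters only, and the set is a finite union of cylinders over words.\<close>

lemma cylindrical_sets:
  assumes "\<And>x y. y \<in> cyl n x \<Longrightarrow> P y \<Longrightarrow> P x"
  shows "{x. P x} \<in> sets M"
proof -
  have "P x \<longleftrightarrow> (\<exists>y\<in>words n. P y \<and> x \<in> cyl n y)" for x
  proof
    assume "P x"
    then have "P (\<lambda>i. i < n \<and> x i)" using assms truncate_mem_cyl(1) by blast
    then show "\<exists>y\<in>words n. P y \<and> x \<in> cyl n y"
      using truncate_mem_words truncate_mem_cyl(1) by blast
  next
    assume "\<exists>y\<in>words n. P y \<and> x \<in> cyl n y"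
    then obtain y where "P y" "x \<in> cyl n y" by auto
    moreover then have "y \<in> cyl n x" by (simp add: cyl_def)
    ultimately show "P x" using assms by blast
  qed
  then have "{x. P x} = (\<Union>y\<in>{y\<in>words n. P y}. cyl n y)"
    by blast
  also have "\<dots> \<in> sets M"
    by (intro sets.finite_UN) (auto simp: finite_words)
  finally show ?thesis .
qed

section \<open>Hausdorff measure: mass distribution and covers by heavy cylinders\<close>

lemma measure_cyl_cong: "y \<in> cyl n x \<Longrightarrow> measure M (cyl n y) = measure M (cyl n x)"
  by (simp add: cyl_eq)

text \<open>Mass distribution principle. On \<open>A N\<close> the mass bound holds from generation
  \<open>N\<close> on, so every fine cover of \<open>E\<close> costs at least the mass of
  \<open>E \<inter> A N\<close>, which is positive for some \<open>N\<close>.\<close>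

lemma hausdorff_measure_pos:
  assumes E: "E \<in> sets M" "emeasure M E > 0" and s: "0 \<le> s" "s < t"
    and ae: "AE x in M. \<forall>\<^sub>F n in sequentially. measure M (cyl n x) \<le> 2 powr (- (real n * t))"
  shows "hausdorff_measure s E \<noteq> 0"
proof -
  define A where "A N = {x. \<forall>n\<ge>N. measure M (cyl n x) \<le> 2 powr (- (real n * t))}" for N
  have "A N = (\<Inter>n\<in>{N..}. {x. measure M (cyl n x) \<le> 2 powr (- (real n * t))})" for N
    by (auto simp: A_def)
  moreover have "{x. measure M (cyl n x) \<le> 2 powr (- (real n * t))} \<in> sets M" for n
    by (rule cylindrical_sets[of n]) (simp add: measure_cyl_cong)
  ultimately have A: "A N \<in> sets M" for N
    by (auto intro!: sets.countable_INT'')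
  have "\<exists>N. emeasure M (E \<inter> A N) > 0"
  proof (rule ccontr)
    assume "\<not> ?thesis"
    then have "E \<inter> A N \<in> null_sets M" for N
      using A E by (auto intro!: null_setsI)
    then have "AE x in M. \<forall>N. x \<notin> E \<inter> A N"
      unfolding AE_all_countable by (intro allI AE_not_in)
    with ae have "AE x in M. x \<notin> E"
      by eventually_elim (auto simp: A_def eventually_sequentially)
    then have "emeasure M E = 0"
      using E by (simp add: AE_iff_measurable[OF E(1)])
    with E show False by simp
  qed
  then obtain N where N: "emeasure M (E \<inter> A N) > 0" by auto
  \<comment> \<open>Covering sets need not be measurable, so the trace on \<open>A N\<close> is
    enclosed in a measurable \<open>B\<close>.\<close>
  have cover: "\<exists>B\<in>sets M. U \<inter> A N \<subseteq> B \<and> emeasure M B \<le> ennreal (cdiam U powr s)"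
    if U: "cdiam U \<le> (1/2) ^ N" for U
  proof (cases "U \<inter> A N = {}")
    case True
    then show ?thesis by (intro bexI[of _ "{}"]) auto
  next
    case False
    then obtain x where x: "x \<in> U" "x \<in> A N" by auto
    show ?thesis
    proof (cases "cdiam U = 0")
      case True
      \<comment> \<open>\<open>U\<close> is a single point and costs \<open>0 powr s = 0\<close>,
        even for \<open>s = 0\<close>, so the point must be null. It is, because
        \<open>0 \<le> s < t\<close> makes the masses of its cylinders tend to 0.\<close>
      have "y = x" if "y \<in> U" for y
        using cdist_le_cdiam[OF that x(1)] True by (simp add: cdist_le_0D)
      then have sub: "U \<inter> A N \<subseteq> (\<Inter>n. cyl n x)" by auto
      have B: "(\<Inter>n. cyl n x) \<in> sets M" by measurable
      have "measure M (\<Inter>n. cyl n x) \<le> 2 powr (- (real n * t))" if "n \<ge> N" for n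
      proof -
        have "measure M (\<Inter>n. cyl n x) \<le> measure M (cyl n x)"
          by (intro finite_measure_mono) auto
        also have "\<dots> \<le> 2 powr (- (real n * t))"
          using x(2) that by (auto simp: A_def)
        finally show ?thesis .
      qed
      moreover have "(\<lambda>n. 2 powr (- (real n * t))) \<longlonglongrightarrow> 0"
        using s by real_asymp
      ultimately have "measure M (\<Inter>n. cyl n x) \<le> 0"
        by (intro LIMSEQ_le_const[of _ 0]) auto
      then have "emeasure M (\<Inter>n. cyl n x) = 0"
        by (simp add: emeasure_eq_measure measure_le_0_iff)
      with B sub show ?thesis by (intro bexI[of _ "\<Inter>n. cyl n x"]) auto
    next
      case nz: False
      with cdiam_nonneg[of U] have "0 < cdiam U" by simp
      then obtain n where n: "(1/2) ^ n \<le> cdiam U" "\<And>x y. cdist x y \<le> cdiam U \<longleftrightarrow> y \<in> cyl n x"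
        using radius_to_generation by metis
      have "(1/2::real) ^ n \<le> (1/2) ^ N" using n(1) U by (rule order_trans)
      then have "N \<le> n" by (simp only: half_power_le_iff)
      have sub: "U \<subseteq> cyl n x"
        using cdist_le_cdiam[OF x(1)] n(2) by blast
      have "measure M (cyl n x) \<le> 2 powr (- (real n * t))"
        using x(2) \<open>N \<le> n\<close> by (auto simp: A_def)
      also have "\<dots> \<le> 2 powr (- (real n * s))"
        using s by (simp add: mult_left_mono)
      also have "\<dots> = ((1/2) ^ n) powr s" by (simp only: half_power_powr)
      also have "\<dots> \<le> cdiam U powr s" using n(1) s by (intro powr_mono2) auto
      finally show ?thesis using sub
        by (intro bexI[of _ "cyl n x"]) (auto simp: emeasure_eq_measure)
    qed
  qed
  have "emeasure M (E \<inter> A N) \<le> hausdorff_pre s ((1/2) ^ N) E"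
    unfolding hausdorff_pre_def
  proof (rule Inf_greatest, clarify)
    fix U :: "nat \<Rightarrow> cpt set"
    assume sub: "E \<subseteq> (\<Union>i. U i)" and diam: "\<forall>i. cdiam (U i) \<le> (1/2) ^ N"
    have "\<forall>i. \<exists>B. B \<in> sets M \<and> U i \<inter> A N \<subseteq> B \<and> emeasure M B \<le> ennreal (cdiam (U i) powr s)"
      using cover diam by blast
    then obtain B where B: "\<And>i. B i \<in> sets M" "\<And>i. U i \<inter> A N \<subseteq> B i"
      "\<And>i. emeasure M (B i) \<le> ennreal (cdiam (U i) powr s)"
      by metis
    have "emeasure M (E \<inter> A N) \<le> emeasure M (\<Union>i. B i)"
    proof (rule emeasure_mono)
      have "E \<inter> A N \<subseteq> (\<Union>i. U i \<inter> A N)" using sub by blast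
      also have "\<dots> \<subseteq> (\<Union>i. B i)" using B(2) by (intro UN_mono) auto
      finally show "E \<inter> A N \<subseteq> (\<Union>i. B i)" .
    qed (use B(1) in auto)
    also have "\<dots> \<le> (\<Sum>i. emeasure M (B i))"
      using B by (intro emeasure_subadditive_countably) auto
    also have "\<dots> \<le> (\<Sum>i. ennreal (cdiam (U i) powr s))"
      using B by (intro suminf_le) auto
    finally show "emeasure M (E \<inter> A N) \<le> (\<Sum>i. ennreal (cdiam (U i) powr s))" .
  qed
  also have "\<dots> \<le> hausdorff_measure s E"
    unfolding hausdorff_measure_def by (intro SUP_upper) auto
  finally show ?thesis using N by auto
qed

text \<open>Distinct words of length \<open>n\<close> have disjoint cylinders, so their masses add
  up to at most 1.\<close>

lemma card_heavy_words:
  "real (card {x\<in>words n. c \<le> measure M (cyl n x)}) * c \<le> 1"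
proof -
  let ?H = "{x\<in>words n. c \<le> measure M (cyl n x)}"
  have fin: "finite ?H" using finite_words by simp
  have disj: "disjoint_family_on (cyl n) ?H"
    unfolding disjoint_family_on_def
  proof (intro ballI impI)
    fix x y assume xy: "x \<in> ?H" "y \<in> ?H" "x \<noteq> y"
    show "cyl n x \<inter> cyl n y = {}"
    proof (rule ccontr)
      assume "cyl n x \<inter> cyl n y \<noteq> {}"
      then have "x \<in> cyl n y" by (auto simp: cyl_def)
      with xy show False using mem_words_cyl_eq by auto
    qed
  qed
  have "real (card ?H) * c \<le> (\<Sum>x\<in>?H. measure M (cyl n x))"
    by (intro sum_bounded_below) auto
  also have "\<dots> = measure M (\<Union>x\<in>?H. cyl n x)"
    using fin disj by (intro finite_measure_finite_Union[symmetric]) auto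
  also have "\<dots> \<le> 1" by (rule prob_le_1)
  finally show ?thesis .
qed

text \<open>Heavy cylinders of generations from \<open>N\<close> on cover \<open>E\<close>. There
  are at most 2^(ns) of them in generation \<open>n\<close>, each costing at most 2^(-nt), so the
  total cost is the tail of a geometric series of ratio \<open>2 powr (s - t)\<close>.\<close>

lemma hausdorff_measure_eq_0:
  assumes s: "0 \<le> t" "s < t"
    and E: "\<And>x. x \<in> E \<Longrightarrow> \<exists>\<^sub>F n in sequentially. 2 powr (- (real n * s)) \<le> measure M (cyl n x)"
  shows "hausdorff_measure t E = 0"
proof -
  define r :: real where "r = 2 powr (s - t)"
  have r: "0 < r" "r < 1" using s powr_less_mono[of "s - t" 0 2] by (auto simp: r_def)
  define heavy where "heavy n = {x\<in>words n. 2 powr (- (real n * s)) \<le> measure M (cyl n x)}" for n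
  have fin_heavy: "finite (heavy n)" for n by (simp add: heavy_def finite_words)
  have heavy_sum: "real (card (heavy n)) * 2 powr (- (real n * t)) \<le> r ^ n" for n
  proof -
    have eq: "2 powr (- (real n * t)) = 2 powr (- (real n * s)) * r ^ n"
      by (simp add: r_def powr_realpow[symmetric] powr_powr powr_add[symmetric] algebra_simps)
    have "real (card (heavy n)) * 2 powr (- (real n * s)) * r ^ n \<le> 1 * r ^ n"
      using card_heavy_words[of n "2 powr (- (real n * s))"] r
      by (intro mult_right_mono) (auto simp: heavy_def)
    then show ?thesis by (simp add: eq mult.assoc)
  qed
  have pre: "hausdorff_pre t \<delta> E \<le> ennreal (r ^ N / (1 - r))" if N: "(1/2) ^ N \<le> \<delta>" for \<delta> N
  proof -
    define C where "C = Sigma {N..} heavy"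
    have countC: "countable C"
      unfolding C_def by (intro countable_SIGMA) (auto intro: countable_finite fin_heavy)
    define idx where "idx = to_nat_on C"
    have inj: "inj_on idx C" unfolding idx_def by (rule inj_on_to_nat_on[OF countC])
    define U where "U i = (if i \<in> idx ` C then (case inv_into C idx i of (n, x) \<Rightarrow> cyl n x) else {})" for i
    have U_idx: "U (idx (n, x)) = cyl n x" if "(n, x) \<in> C" for n x
      using that inj by (auto simp: U_def)
    have U_cases: "U i = {} \<or> (\<exists>n x. (n, x) \<in> C \<and> i = idx (n, x))" for i
      by (auto simp: U_def)
    have "E \<subseteq> (\<Union>i. U i)"
    proof
      fix x assume "x \<in> E"
      then obtain n where n: "n \<ge> N" "2 powr (- (real n * s)) \<le> measure M (cyl n x)"
        using E unfolding frequently_sequentially by meson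
      let ?y = "\<lambda>i. i < n \<and> x i"
      have "(n, ?y) \<in> C"
        using n truncate_mem_words[of n x] measure_cyl_cong[OF truncate_mem_cyl(2), of n x]
        by (auto simp: C_def heavy_def)
      then show "x \<in> (\<Union>i. U i)" using U_idx truncate_mem_cyl(1)[of x n] by blast
    qed
    moreover have "cdiam (U i) \<le> \<delta>" for i
    proof (cases "U i = {}")
      case True
      have "0 \<le> \<delta>" using N by (meson order_trans zero_le_power half_gt_zero less_imp_le zero_less_one)
      with True show ?thesis by (simp add: cdiam_def)
    next
      case False
      then obtain n x where nx: "(n, x) \<in> C" "i = idx (n, x)" using U_cases by blast
      have "cdiam (U i) \<le> (1/2) ^ n" using nx U_idx cdiam_cyl_le by simp
      also have "\<dots> \<le> (1/2) ^ N" using nx by (intro power_decreasing) (auto simp: C_def)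
      finally show ?thesis using N by simp
    qed
    ultimately have "hausdorff_pre t \<delta> E \<le> (\<Sum>i. ennreal (cdiam (U i) powr t))"
      unfolding hausdorff_pre_def by (intro Inf_lower) blast
    also have "\<dots> \<le> ennreal (r ^ N / (1 - r))"
    proof (rule suminf_le_const)
      fix m
      define B where "B = {c\<in>C. idx c < m}"
      have finB: "finite B"
      proof (rule finite_imageD)
        show "finite (idx ` B)" by (rule finite_subset[of _ "{..<m}"]) (auto simp: B_def)
        show "inj_on idx B" using inj by (rule inj_on_subset) (auto simp: B_def)
      qed
      \<comment> \<open>The finitely many cylinders of a partial sum have bounded generation, so a
        finite geometric sum dominates it. Inserting \<open>N\<close> keeps the maximum defined when
        \<open>B\<close> is empty.\<close>
      define K where "K = Max (insert N (fst ` B))"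
      have BK: "B \<subseteq> Sigma {N..K} heavy"
      proof
        fix c assume c: "c \<in> B"
        then have "fst c \<le> K" unfolding K_def using finB by (intro Max_ge) auto
        with c show "c \<in> Sigma {N..K} heavy" by (cases c) (auto simp: B_def C_def)
      qed
      have "(\<Sum>i<m. cdiam (U i) powr t) = (\<Sum>i\<in>idx ` B. cdiam (U i) powr t)"
      proof (rule sum.mono_neutral_right)
        show "\<forall>i\<in>{..<m} - idx ` B. cdiam (U i) powr t = 0"
          using U_cases by (auto simp: B_def cdiam_def)
      qed (auto simp: B_def)
      also have "\<dots> = (\<Sum>c\<in>B. cdiam (U (idx c)) powr t)"
        using inj by (subst sum.reindex) (auto simp: B_def intro: inj_on_subset)
      also have "\<dots> \<le> (\<Sum>c\<in>B. 2 powr (- (real (fst c) * t)))"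
      proof (intro sum_mono)
        fix c assume "c \<in> B"
        then have "U (idx c) = cyl (fst c) (snd c)" using U_idx by (cases c) (auto simp: B_def)
        then have "cdiam (U (idx c)) powr t \<le> ((1/2) ^ fst c) powr t"
          using s by (auto intro!: powr_mono2 cdiam_nonneg cdiam_cyl_le)
        then show "cdiam (U (idx c)) powr t \<le> 2 powr (- (real (fst c) * t))"
          by (simp only: half_power_powr)
      qed
      also have "\<dots> \<le> (\<Sum>c\<in>Sigma {N..K} heavy. 2 powr (- (real (fst c) * t)))"
        by (intro sum_mono2 BK) (auto simp: fin_heavy)
      also have "\<dots> = (\<Sum>n=N..K. real (card (heavy n)) * 2 powr (- (real n * t)))"
        using sum.Sigma[of "{N..K}" heavy "\<lambda>n x. 2 powr (- (real n * t))"]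
        by (simp add: fin_heavy split_beta)
      also have "\<dots> \<le> (\<Sum>n=N..K. r ^ n)"
        by (intro sum_mono heavy_sum)
      also have "\<dots> \<le> r ^ N / (1 - r)"
        using r by (auto simp: sum_gp divide_right_mono)
      finally have "(\<Sum>i<m. cdiam (U i) powr t) \<le> r ^ N / (1 - r)" .
      then show "(\<Sum>i<m. ennreal (cdiam (U i) powr t)) \<le> ennreal (r ^ N / (1 - r))"
        by (subst sum_ennreal) (auto intro: ennreal_leI)
    qed auto
    finally show ?thesis .
  qed
  have "hausdorff_pre t \<delta> E \<le> 0" if \<delta>: "0 < \<delta>" for \<delta>
  proof -
    obtain N where N: "(1/2) ^ N \<le> \<delta>" using half_power_le_obtain[OF \<delta>] .
    have "hausdorff_pre t \<delta> E \<le> ennreal (r ^ n / (1 - r))" if "N \<le> n" for n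
    proof (rule pre)
      have "(1/2) ^ n \<le> ((1/2) ^ N :: real)" using that by (intro power_decreasing) auto
      then show "(1/2) ^ n \<le> \<delta>" using N by (rule order_trans)
    qed
    moreover have "(\<lambda>n. r ^ n / (1 - r)) \<longlonglongrightarrow> 0"
      using r by (intro tendsto_divide_zero LIMSEQ_realpow_zero) auto
    then have "(\<lambda>n. ennreal (r ^ n / (1 - r))) \<longlonglongrightarrow> 0"
      by (metis ennreal_0 tendsto_ennrealI)
    ultimately show ?thesis by (intro LIMSEQ_le_const[of _ 0]) auto
  qed
  then show ?thesis unfolding hausdorff_measure_def by (auto simp: SUP_eq_iff bot_ennreal)
qed

section \<open>Packing measure: upper and lower estimates\<close>

lemma packing_measure_eq_0:
  assumes s: "0 \<le> t" "s < t"
    and E: "\<And>x. x \<in> E \<Longrightarrow> \<forall>\<^sub>F n in sequentially. 2 powr (- (real n * s)) \<le> measure M (cyl n x)"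
  shows "packing_measure t E = 0"
proof -
  define r :: real where "r = 2 powr (s - t)"
  have r: "0 < r" "r < 1" using s powr_less_mono[of "s - t" 0 2] by (auto simp: r_def)
  \<comment> \<open>\<open>E\<close> is covered by the countably many \<open>A N\<close>, so it
    suffices that the premeasure vanishes on each. There the balls of a packing are disjoint
    cylinders of generation at least \<open>K\<close>, each costing at most
    \<open>4 powr t * r ^ K\<close> times its mass.\<close>
  define A where "A N = {x. \<forall>n\<ge>N. 2 powr (- (real n * s)) \<le> measure M (cyl n x)}" for N
  have pre: "packing_pre t ((1/2) ^ K) (A N) \<le> ennreal (4 powr t * r ^ K)" if "N \<le> K" for N K
    unfolding packing_pre_def
  proof (rule Sup_least, clarify)
    fix P :: "(cpt \<times> real) set"
    assume fin: "finite P" and P: "\<forall>(x,\<rho>)\<in>P. x \<in> A N \<and> 0 < \<rho> \<and> \<rho> \<le> (1/2) ^ K"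
      and disj: "\<forall>a\<in>P. \<forall>b\<in>P. a \<noteq> b \<longrightarrow> ccball (fst a) (snd a) \<inter> ccball (fst b) (snd b) = {}"
    have bnd: "ccball (fst c) (snd c) \<in> sets M \<and>
      (2 * snd c) powr t \<le> 4 powr t * r ^ K * measure M (ccball (fst c) (snd c))" if "c \<in> P" for c
    proof -
      obtain x \<rho> where c: "c = (x, \<rho>)" by (cases c)
      have x: "x \<in> A N" "0 < \<rho>" "\<rho> \<le> (1/2) ^ K" using P that c by auto
      obtain n where n: "(1/2) ^ n \<le> \<rho>" "\<And>x y. cdist x y \<le> \<rho> \<longleftrightarrow> y \<in> cyl n x"
        "\<rho> \<le> 1 \<Longrightarrow> \<rho> \<le> 2 * (1/2) ^ n"
        using radius_to_generation[OF x(2)] by metis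
      have ball: "ccball x \<rho> = cyl n x" by (simp add: ccball_def n)
      have "(1/2) ^ n \<le> (1/2::real) ^ K" using n(1) x(3) by (rule order_trans)
      then have K: "K \<le> n" by (simp only: half_power_le_iff)
      have "(1/2::real) ^ K \<le> 1" by (simp add: power_le_one)
      then have "\<rho> \<le> 2 * (1/2) ^ n" using n(3) x(3) by simp
      \<comment> \<open>One factor 2 is the diameter \<open>2 * \<rho>\<close> in the premeasure,
        the other comes from \<open>\<rho> \<le> 2 * (1/2) ^ n\<close>.\<close>
      then have "(2 * \<rho>) powr t \<le> (4 * (1/2) ^ n) powr t"
        using x s by (intro powr_mono2) auto
      also have "\<dots> = 4 powr t * 2 powr (- (real n * t))"
        by (subst powr_mult) (simp_all only: half_power_powr)
      also have "2 powr (- (real n * t)) = r ^ n * 2 powr (- (real n * s))"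
        by (simp add: r_def powr_realpow[symmetric] powr_powr powr_add[symmetric] algebra_simps)
      also have "r ^ n * 2 powr (- (real n * s)) \<le> r ^ K * measure M (cyl n x)"
        using r K that x(1) \<open>N \<le> K\<close> by (intro mult_mono power_decreasing) (auto simp: A_def)
      finally show ?thesis using c ball by (simp add: mult.assoc)
    qed
    have "(\<Sum>c\<in>P. (2 * snd c) powr t) \<le> (\<Sum>c\<in>P. 4 powr t * r ^ K * measure M (ccball (fst c) (snd c)))"
      using bnd by (intro sum_mono) auto
    also have "\<dots> = 4 powr t * r ^ K * (\<Sum>c\<in>P. measure M (ccball (fst c) (snd c)))"
      by (simp add: sum_distrib_left)
    also have "(\<Sum>c\<in>P. measure M (ccball (fst c) (snd c))) = measure M (\<Union>c\<in>P. ccball (fst c) (snd c))"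
      using fin bnd disj
      by (intro finite_measure_finite_Union[symmetric]) (auto simp: disjoint_family_on_def)
    also have "4 powr t * r ^ K * \<dots> \<le> 4 powr t * r ^ K * 1"
      using r by (intro mult_left_mono) auto
    finally have "(\<Sum>c\<in>P. (2 * snd c) powr t) \<le> 4 powr t * r ^ K" by simp
    then show "(\<Sum>(x,\<rho>)\<in>P. ennreal ((2 * \<rho>) powr t)) \<le> ennreal (4 powr t * r ^ K)"
      by (simp add: split_beta sum_ennreal ennreal_leI)
  qed
  have pre0: "packing_pre0 t (A N) \<le> 0" for N
  proof -
    have "packing_pre0 t (A N) \<le> ennreal (4 powr t * r ^ K)" if "N \<le> K" for K
    proof -
      have "packing_pre0 t (A N) \<le> packing_pre t ((1/2) ^ K) (A N)"
        unfolding packing_pre0_def by (intro INF_lower) auto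
      also note pre[OF that]
      finally show ?thesis .
    qed
    moreover have "(\<lambda>K. 4 powr t * r ^ K) \<longlonglongrightarrow> 0"
      using r by (intro tendsto_mult_right_zero LIMSEQ_realpow_zero) auto
    then have "(\<lambda>K. ennreal (4 powr t * r ^ K)) \<longlonglongrightarrow> 0"
      by (metis ennreal_0 tendsto_ennrealI)
    ultimately show ?thesis by (intro LIMSEQ_le_const[of _ 0]) auto
  qed
  have "E \<subseteq> (\<Union>N. A N)"
    using E by (auto simp: A_def eventually_sequentially)
  then have "packing_measure t E \<le> (\<Sum>N. packing_pre0 t (A N))"
    unfolding packing_measure_def by (intro Inf_lower) blast
  also have "\<dots> = 0" using pre0 by simp
  finally show ?thesis by simp
qed

text \<open>Each point of \<open>A\<close> is given its first light cylinder of generation at least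
  \<open>N\<close>. By minimality these cylinders coincide or are disjoint, so they form a packing
  directly, and lightness bounds the mass of their union \<open>B\<close> by the packing
  sum.\<close>

lemma packing_pre_ge_measure:
  assumes A: "\<And>x. x \<in> A \<Longrightarrow> \<exists>\<^sub>F n in sequentially. measure M (cyl n x) \<le> 2 powr (- (real n * s))"
    and AU: "A \<subseteq> U" and s: "0 \<le> s"
  shows "\<exists>B\<in>sets M. A \<subseteq> B \<and> emeasure M B \<le> packing_pre s ((1/2) ^ N) U"
proof -
  define light where "light x n \<longleftrightarrow> N \<le> n \<and> measure M (cyl n x) \<le> 2 powr (- (real n * s))" for x n
  define g where "g x = (LEAST n. light x n)" for x
  have g: "light x (g x)" if "x \<in> A" for x
  proof -
    have "\<exists>n. light x n" using A[OF that] unfolding frequently_sequentially light_def by meson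
    then show ?thesis unfolding g_def by (rule LeastI_ex)
  qed
  have g_least: "g x \<le> n" if "light x n" for x n
    unfolding g_def using that by (rule Least_le)
  have light_cong: "light y n \<longleftrightarrow> light x n" if "y \<in> cyl n x" for x y n
    using measure_cyl_cong[OF that] by (simp add: light_def)
  \<comment> \<open>If the two cylinders meet, the later point lies in the earlier cylinder and
    inherits its lightness at generation \<open>g x\<close>; minimality of \<open>g y\<close> then
    forces equality.\<close>
  have g_eq: "g x = g y" if xy: "x \<in> A" "y \<in> A" "cyl (g x) x \<inter> cyl (g y) y \<noteq> {}" "g x \<le> g y" for x y
  proof -
    have "y \<in> cyl (g x) x" using xy(3,4) by (auto simp: cyl_def)
    then have "light y (g x)" using g[OF xy(1)] light_cong by blast
    then show ?thesis using g_least xy(4) by (simp add: order_antisym)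
  qed
  have meet: "cyl (g x) x = cyl (g y) y \<and> g x = g y"
    if xy: "x \<in> A" "y \<in> A" "cyl (g x) x \<inter> cyl (g y) y \<noteq> {}" for x y
  proof -
    have "g x = g y"
      using g_eq[of x y] g_eq[of y x] xy by (cases "g x \<le> g y") (auto simp: Int_commute)
    then show ?thesis using xy(3) by (auto simp: cyl_def)
  qed
  define C where "C = (\<lambda>x. cyl (g x) x) ` A"
  have C_sub: "C \<subseteq> (\<Union>n. gen n)" by (auto simp: C_def gen_def)
  have "countable (\<Union>n. gen n)"
    by (rule countable_UN) (auto simp: gen_eq_words finite_words countable_finite)
  then have countC: "countable C" using C_sub countable_subset by blast
  have C_sets: "C \<subseteq> sets M" by (auto simp: C_def)
  have disjC: "disjoint C"
    using meet by (auto simp: C_def disjoint_def)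
  have "A \<subseteq> \<Union>C" by (auto simp: C_def)
  moreover have "\<Union>C \<in> sets M" using C_sets countC by (rule sets.countable_Union[rotated])
  moreover have "emeasure M (\<Union>C) \<le> packing_pre s ((1/2) ^ N) U"
  proof -
    have fin: "emeasure M (\<Union>F) \<le> packing_pre s ((1/2) ^ N) U" if F: "finite F" "F \<subseteq> C" for F
    proof -
      \<comment> \<open>One centre is kept per cylinder, so that different pairs of the packing have
        disjoint balls.\<close>
      obtain X where X: "X \<subseteq> A" "F = (\<lambda>x. cyl (g x) x) ` X" "inj_on (\<lambda>x. cyl (g x) x) X"
        using F(2) unfolding C_def by (meson subset_image_inj)
      have finX: "finite X" using F(1) X by (simp add: finite_image_iff)
      define P where "P = (\<lambda>x. (x, (1/2::real) ^ g x)) ` X"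
      have "emeasure M (\<Union>F) \<le> (\<Sum>x\<in>X. emeasure M (cyl (g x) x))"
        unfolding X(2) using finX by (intro emeasure_subadditive_finite) auto
      also have "\<dots> \<le> (\<Sum>x\<in>X. ennreal ((2 * (1/2) ^ g x) powr s))"
      proof (intro sum_mono)
        fix x assume "x \<in> X"
        then have "measure M (cyl (g x) x) \<le> 2 powr (- (real (g x) * s))"
          using g X by (auto simp: light_def)
        also have "\<dots> = ((1/2) ^ g x) powr s" by (simp only: half_power_powr)
        also have "\<dots> \<le> (2 * (1/2) ^ g x) powr s" using s by (intro powr_mono2) auto
        finally show "emeasure M (cyl (g x) x) \<le> ennreal ((2 * (1/2) ^ g x) powr s)"
          by (simp add: emeasure_eq_measure ennreal_leI)
      qed
      also have "\<dots> = (\<Sum>(x,\<rho>)\<in>P. ennreal ((2 * \<rho>) powr s))"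
        unfolding P_def by (subst sum.reindex) (auto simp: inj_on_def)
      also have "\<dots> \<le> packing_pre s ((1/2) ^ N) U"
      proof -
        have 1: "finite P" using finX by (simp add: P_def)
        have 2: "\<forall>(x,\<rho>)\<in>P. x \<in> U \<and> 0 < \<rho> \<and> \<rho> \<le> (1/2) ^ N"
        proof (clarify)
          fix x \<rho> assume "(x, \<rho>) \<in> P"
          then have x: "x \<in> X" "\<rho> = (1/2) ^ g x" by (auto simp: P_def)
          then have "N \<le> g x" using g X by (auto simp: light_def)
          then have "(1/2::real) ^ g x \<le> (1/2) ^ N" by (intro power_decreasing) auto
          then show "x \<in> U \<and> 0 < \<rho> \<and> \<rho> \<le> (1/2) ^ N" using x X AU by auto
        qed
        have 3: "\<forall>a\<in>P. \<forall>b\<in>P. a \<noteq> b \<longrightarrow> ccball (fst a) (snd a) \<inter> ccball (fst b) (snd b) = {}"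
        proof (intro ballI impI)
          fix a b assume "a \<in> P" "b \<in> P" "a \<noteq> b"
          then obtain x y where xy: "x \<in> X" "y \<in> X" "a = (x, (1/2) ^ g x)" "b = (y, (1/2) ^ g y)" "x \<noteq> y"
            by (auto simp: P_def)
          have "cyl (g x) x \<noteq> cyl (g y) y" using X(3) xy by (auto dest: inj_onD)
          then have "cyl (g x) x \<inter> cyl (g y) y = {}" using meet[of x y] xy X by blast
          then show "ccball (fst a) (snd a) \<inter> ccball (fst b) (snd b) = {}"
            using xy by (simp add: ccball_power)
        qed
        show ?thesis unfolding packing_pre_def
          by (rule Sup_upper) (use 1 2 3 in blast)
      qed
      finally show ?thesis .
    qed
    show ?thesis
    proof (cases "C = {}")
      case False
      \<comment> \<open>Packings are finite while \<open>C\<close> may be infinite: \<open>C\<close>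
        is exhausted by finite subfamilies, and continuity from below gives the bound for the
        union.\<close>
      define F where "F i = from_nat_into C ` {..i}" for i
      have F: "finite (F i)" "F i \<subseteq> C" for i
        using from_nat_into[OF False] by (auto simp: F_def)
      have "\<Union>C = (\<Union>i. \<Union>(F i))"
      proof -
        have "(\<Union>i. F i) = range (from_nat_into C)" by (auto simp: F_def)
        also have "\<dots> = C" using False countC by (simp add: range_from_nat_into)
        finally show ?thesis by auto
      qed
      moreover have "incseq (\<lambda>i. \<Union>(F i))"
        by (intro incseq_SucI Union_mono) (auto simp: F_def atMost_Suc)
      moreover have "range (\<lambda>i. \<Union>(F i)) \<subseteq> sets M"
        using F C_sets by (auto intro!: sets.finite_Union)
      ultimately have "emeasure M (\<Union>C) = (SUP i. emeasure M (\<Union>(F i)))"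
        by (simp add: SUP_emeasure_incseq)
      also have "\<dots> \<le> packing_pre s ((1/2) ^ N) U"
        using fin F by (intro SUP_least) auto
      finally show ?thesis .
    qed simp
  qed
  ultimately show ?thesis by blast
qed

lemma packing_pre_mono: "\<delta> \<le> \<delta>' \<Longrightarrow> packing_pre s \<delta> U \<le> packing_pre s \<delta>' U"
  unfolding packing_pre_def by (rule Sup_subset_mono) fastforce

text \<open>Almost every point of \<open>E\<close> has light cylinders infinitely often. The pieces
  of a cover are arbitrary sets, so their traces on \<open>G\<close> are enclosed in measurable sets
  whose masses the premeasure dominates.\<close>

lemma packing_measure_pos:
  assumes E: "E \<in> sets M" "emeasure M E > 0" and s: "0 \<le> s"
    and ae: "AE x in M. \<exists>\<^sub>F n in sequentially. measure M (cyl n x) \<le> 2 powr (- (real n * s))"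
  shows "packing_measure s E \<noteq> 0"
proof -
  define G where "G = {x. \<exists>\<^sub>F n in sequentially. measure M (cyl n x) \<le> 2 powr (- (real n * s))}"
  have "emeasure M E \<le> packing_measure s E"
    unfolding packing_measure_def
  proof (rule Inf_greatest, clarify)
    fix U :: "nat \<Rightarrow> cpt set"
    assume U: "E \<subseteq> (\<Union>i. U i)"
    have "\<exists>B\<in>sets M. U i \<inter> G \<subseteq> B \<and> emeasure M B \<le> packing_pre s ((1/2) ^ N) (U i)" for i N
      by (rule packing_pre_ge_measure) (use s in \<open>auto simp: G_def\<close>)
    then have "\<forall>i N. \<exists>B. B \<in> sets M \<and> U i \<inter> G \<subseteq> B \<and> emeasure M B \<le> packing_pre s ((1/2) ^ N) (U i)"
      by blast
    then obtain B where B: "\<And>i N. B i N \<in> sets M" "\<And>i N. U i \<inter> G \<subseteq> B i N"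
      "\<And>i N. emeasure M (B i N) \<le> packing_pre s ((1/2) ^ N) (U i)"
      by metis
    \<comment> \<open>Intersecting over all scales yields one enclosing set whose mass is below the
      premeasure at every \<open>\<delta>\<close>, hence below the infimum.\<close>
    define D where "D i = (\<Inter>N. B i N)" for i
    have D: "D i \<in> sets M" for i unfolding D_def using B(1) by blast
    have D_le: "emeasure M (D i) \<le> packing_pre0 s (U i)" for i
      unfolding packing_pre0_def
    proof (rule INF_greatest)
      fix \<delta> :: real assume "\<delta> \<in> {0<..}"
      then obtain N where N: "(1/2) ^ N \<le> \<delta>" using half_power_le_obtain[of \<delta>] by auto
      have "emeasure M (D i) \<le> emeasure M (B i N)"
        using B(1) by (intro emeasure_mono) (auto simp: D_def)
      also have "\<dots> \<le> packing_pre s ((1/2) ^ N) (U i)" by (rule B)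
      also have "\<dots> \<le> packing_pre s \<delta> (U i)" by (rule packing_pre_mono[OF N])
      finally show "emeasure M (D i) \<le> packing_pre s \<delta> (U i)" .
    qed
    have "emeasure M E \<le> emeasure M (\<Union>i. D i)"
    proof (rule emeasure_mono_AE)
      show "AE x in M. x \<in> E \<longrightarrow> x \<in> (\<Union>i. D i)"
        using ae
      proof eventually_elim
        case (elim x)
        then have "x \<in> G" by (simp add: G_def)
        then have "x \<in> D i" if "x \<in> U i" for i using that B(2) unfolding D_def by blast
        then show ?case using U by blast
      qed
    qed (use D in auto)
    also have "\<dots> \<le> (\<Sum>i. emeasure M (D i))"
      using D by (intro emeasure_subadditive_countably) auto
    also have "\<dots> \<le> (\<Sum>i. packing_pre0 s (U i))"
      using D_le by (intro suminf_le) auto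
    finally show "emeasure M E \<le> (\<Sum>i. packing_pre0 s (U i))" .
  qed
  then show ?thesis using E by auto
qed

end


section \<open>Variance of the information function\<close>

definition binent :: "real \<Rightarrow> real" where
  "binent t = - (t * ln t) - (1 - t) * ln (1 - t)"

text \<open>This is \<open>ln u \<le> u - 1\<close> at \<open>u = 1 / sqrt t\<close>. The right side
  keeps the decay as \<open>t\<close> tends to 1, and another factor \<open>sqrt t\<close> gives
  decay at 0.\<close>

lemma sqrt_mult_neg_ln:
  assumes "0 \<le> t" "t \<le> 1" shows "sqrt t * - ln t \<le> 2 * (1 - sqrt t)"
proof (cases "t = 0")
  case False
  then have t: "0 < t" using assms by simp
  have "ln (1 / sqrt t) \<le> 1 / sqrt t - 1"
    using t by (intro ln_le_minus_one) auto
  then have "- ln t \<le> 2 * (1 / sqrt t - 1)"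
    using t by (simp add: ln_div ln_sqrt)
  then have "sqrt t * - ln t \<le> sqrt t * (2 * (1 / sqrt t - 1))"
    using t by (intro mult_left_mono) auto
  also have "\<dots> = 2 * (1 - sqrt t)" using t by (simp add: right_diff_distrib)
  finally show ?thesis .
qed simp

lemma neg_ln_nonneg: "0 \<le> t \<Longrightarrow> t \<le> 1 \<Longrightarrow> 0 \<le> - ln (t::real)"
  by (cases "t = 0") auto

text \<open>With \<open>u = sqrt t\<close> one has
  \<open>t * - ln t \<le> 2 * (u * (1 - u))\<close>, which yields the first three estimates;
  squaring \<open>u * - ln t \<le> 2\<close> yields the last.\<close>

lemma mult_neg_ln_bounds:
  assumes "0 \<le> t" "t \<le> 1"
  shows "t * - ln t \<le> 1/2" "t * - ln t \<le> 2 * sqrt t" "t * - ln t \<le> 2 * sqrt (1 - t)"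
    "t * (ln t)\<^sup>2 \<le> 4"
proof -
  define u where "u = sqrt t"
  have u: "0 \<le> u" "u \<le> 1" "t = u * u" using assms by (auto simp: u_def)
  have ln: "u * - ln t \<le> 2 * (1 - u)" using sqrt_mult_neg_ln[OF assms] by (simp add: u_def)
  have nn: "0 \<le> - ln t" by (rule neg_ln_nonneg[OF assms])
  have le: "t * - ln t \<le> 2 * (u * (1 - u))"
    using mult_left_mono[OF ln u(1)] u(3) by (simp add: algebra_simps)
  have "0 \<le> (2 * u - 1)\<^sup>2" by simp
  then have "u * (1 - u) \<le> 1/4" by (simp add: power2_eq_square algebra_simps)
  with le show "t * - ln t \<le> 1/2" by simp
  have "u * (1 - u) \<le> u * 1" using u by (intro mult_left_mono) auto
  with le show "t * - ln t \<le> 2 * sqrt t" by (simp add: u_def)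
  have tu: "t \<le> u" using u mult_left_mono[of u 1 u] by simp
  have "u * (1 - u) \<le> 1 * (1 - t)" using u tu by (intro mult_mono) auto
  also have "1 - t \<le> sqrt (1 - t)"
    using assms by (intro real_le_rsqrt) (simp add: power2_eq_square mult_left_le)
  finally show "t * - ln t \<le> 2 * sqrt (1 - t)" using le by simp
  have "0 \<le> u * - ln t" using u(1) nn by (rule mult_nonneg_nonneg)
  moreover have "u * - ln t \<le> 2" by (rule order_trans[OF ln]) (use u in simp)
  ultimately have "(u * - ln t)\<^sup>2 \<le> 2\<^sup>2" by (intro power_mono)
  then show "t * (ln t)\<^sup>2 \<le> 4" using u(3) by (simp add: power2_eq_square algebra_simps)
qed

lemma binent_bounds:
  assumes "0 \<le> t" "t \<le> 1"
  shows "0 \<le> binent t" "binent t \<le> 1" "binent t \<le> 4 * sqrt t" "binent t \<le> 4 * sqrt (1 - t)"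
proof -
  have t': "0 \<le> 1 - t" "1 - t \<le> 1" using assms by auto
  have eq: "binent t = t * - ln t + (1 - t) * - ln (1 - t)" by (simp add: binent_def)
  show "0 \<le> binent t" unfolding eq
    using assms t' neg_ln_nonneg[OF assms] neg_ln_nonneg[OF t'] by (intro add_nonneg_nonneg mult_nonneg_nonneg) auto
  show "binent t \<le> 1" "binent t \<le> 4 * sqrt t" "binent t \<le> 4 * sqrt (1 - t)" unfolding eq
    using mult_neg_ln_bounds[OF assms] mult_neg_ln_bounds[OF t'] by auto
qed

text \<open>Both entropies are nonnegative, so it suffices to bound each. If
  \<open>a \<le> b\<close> then \<open>1 - \<bar>a - b\<bar>\<close> is at least \<open>a\<close>,
  otherwise at least \<open>1 - a\<close>; the square-root bounds for \<open>binent\<close> at the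
  two ends finish.\<close>

lemma binent_diff_le:
  assumes "0 \<le> a" "a \<le> 1" "0 \<le> b" "b \<le> 1"
  shows "\<bar>binent a - binent b\<bar> \<le> 4 * sqrt (1 - \<bar>a - b\<bar>)"
proof -
  have one: "binent a \<le> 4 * sqrt (1 - \<bar>a - b\<bar>)" if "0 \<le> a" "a \<le> 1" "0 \<le> b" "b \<le> 1" for a b :: real
  proof (cases "a \<le> b")
    case True
    then have "sqrt a \<le> sqrt (1 - \<bar>a - b\<bar>)" using that by simp
    with binent_bounds(3)[OF that(1,2)] show ?thesis by linarith
  next
    case False
    then have "sqrt (1 - a) \<le> sqrt (1 - \<bar>a - b\<bar>)" using that by simp
    with binent_bounds(4)[OF that(1,2)] show ?thesis by linarith
  qed
  show ?thesis
    using one[OF assms] one[OF assms(3,4,1,2)] binent_bounds(1)[OF assms(1,2)] binent_bounds(1)[OF assms(3,4)]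
    by (simp add: abs_minus_commute[of b a] abs_le_iff)
qed

section \<open>Finite averages along the Markov chain\<close>

lemma sum_words_Suc:
  "(\<Sum>x\<in>words (Suc n). F x) = (\<Sum>x\<in>words n. F x + F (x(n := True)))"
  for F :: "cpt \<Rightarrow> 'a::comm_monoid_add"
proof -
  have disj: "words n \<inter> (\<lambda>x. x(n := True)) ` words n = {}"
    by (auto simp: words_def)
  have inj: "inj_on (\<lambda>x. x(n := True)) (words n)"
  proof (rule inj_onI)
    fix x y :: cpt assume xy: "x \<in> words n" "y \<in> words n" "x(n := True) = y(n := True)"
    show "x = y"
    proof
      fix i show "x i = y i"
        using fun_cong[OF xy(3), of i] xy(1,2) by (cases "i = n") (auto simp: words_def)
    qed
  qed
  show ?thesis
    unfolding words_Suc using disj inj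
    by (subst sum.union_disjoint) (auto simp: finite_words sum.reindex sum.distrib)
qed

locale markov_params =
  fixes p q :: "nat \<Rightarrow> real"
  assumes p_bounds: "0 \<le> p n" "p n \<le> 1" and q_bounds: "0 \<le> q n" "q n \<le> 1"
begin

text \<open>At \<open>n = 0\<close> the missing previous letter counts as 0, so that
  \<open>p 0\<close> is the initial law.\<close>

definition prev :: "nat \<Rightarrow> cpt \<Rightarrow> bool" where
  "prev n x \<longleftrightarrow> 0 < n \<and> x (n - 1)"

definition zprob :: "nat \<Rightarrow> cpt \<Rightarrow> real" where
  "zprob n x = (if prev n x then q n else p n)"

definition wt :: "nat \<Rightarrow> cpt \<Rightarrow> real" where
  "wt n x = (\<Prod>i<n. mfactor p q x i)"

text \<open>A vanishing factor contributes \<open>ln 0 = 0\<close>; this happens only on a null set.\<close>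
definition info :: "nat \<Rightarrow> cpt \<Rightarrow> real" where
  "info n x = (\<Sum>i<n. - ln (mfactor p q x i))"

text \<open>For \<open>F\<close> depending on the first \<open>n\<close> letters this is its
  integral. The finite sum makes the recursions below plain algebra.\<close>

definition mean :: "nat \<Rightarrow> (cpt \<Rightarrow> real) \<Rightarrow> real" where
  "mean n F = (\<Sum>x\<in>words n. wt n x * F x)"

lemma mfactor_eq: "mfactor p q x n = (if x n then 1 - zprob n x else zprob n x)"
  by (auto simp: mfactor_def zprob_def prev_def)

lemma zprob_bounds: "0 \<le> zprob n x" "zprob n x \<le> 1"
  using p_bounds q_bounds by (auto simp: zprob_def)

lemma mfactor_bounds: "0 \<le> mfactor p q x n" "mfactor p q x n \<le> 1"
  using zprob_bounds[of n x] by (auto simp: mfactor_eq)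

lemma mfactor_cong: "y \<in> cyl n x \<Longrightarrow> i < n \<Longrightarrow> mfactor p q y i = mfactor p q x i"
  by (auto simp: mfactor_def cyl_def)

lemma wt_cong: "y \<in> cyl n x \<Longrightarrow> wt n y = wt n x"
  unfolding wt_def by (intro prod.cong) (auto simp: mfactor_cong)

lemma info_cong: "y \<in> cyl n x \<Longrightarrow> info n y = info n x"
  unfolding info_def by (intro sum.cong) (auto simp: mfactor_cong)

lemma upd_mem_cyl: "x(n := b) \<in> cyl n x"
  by (simp add: cyl_def)

lemma wt_nonneg: "0 \<le> wt n x"
  unfolding wt_def by (intro prod_nonneg) (use mfactor_bounds in auto)

lemma zprob_upd [simp]: "zprob n (x(n := b)) = zprob n x"
  by (cases n) (auto simp: zprob_def prev_def)

lemma info_Suc: "info (Suc n) x = info n x - ln (mfactor p q x n)"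
  by (simp add: info_def)

lemma info_mono: "mono (\<lambda>n. info n x)"
  by (intro mono_iff_le_Suc[THEN iffD2] allI) (use neg_ln_nonneg[OF mfactor_bounds] in \<open>simp add: info_Suc\<close>)

text \<open>Conditioning on the first \<open>n\<close> letters: a word of length \<open>n\<close>
  already has letter 0 at position \<open>n\<close>, and \<open>x(n := True)\<close> is the other
  branch.\<close>

lemma mean_Suc:
  "mean (Suc n) F = mean n (\<lambda>x. zprob n x * F x + (1 - zprob n x) * F (x(n := True)))"
proof -
  have "wt (Suc n) x = wt n x * zprob n x" if "x \<in> words n" for x
    using that by (simp add: wt_def mfactor_eq words_def)
  moreover have "wt (Suc n) (x(n := True)) = wt n x * (1 - zprob n x)" if "x \<in> words n" for x
    using wt_cong[OF upd_mem_cyl, of n x True] by (simp add: wt_def mfactor_eq)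
  ultimately show ?thesis
    unfolding mean_def sum_words_Suc by (intro sum.cong) (simp_all add: distrib_left mult.assoc)
qed

lemma mean_cong: "(\<And>x. x \<in> words n \<Longrightarrow> F x = G x) \<Longrightarrow> mean n F = mean n G"
  unfolding mean_def by (intro sum.cong) auto

lemma mean_add: "mean n (\<lambda>x. F x + G x) = mean n F + mean n G"
  by (simp add: mean_def sum.distrib algebra_simps)

lemma mean_diff: "mean n (\<lambda>x. F x - G x) = mean n F - mean n G"
  by (simp add: mean_def sum_subtractf algebra_simps)

lemma mean_cmult: "mean n (\<lambda>x. c * F x) = c * mean n F"
  by (simp add: mean_def sum_distrib_left algebra_simps)

lemma mean_1: "mean n (\<lambda>x. 1) = 1"
proof (induction n)
  case 0
  then show ?case by (simp add: mean_def words_0 wt_def)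
next
  case (Suc n)
  have "mean (Suc n) (\<lambda>x. 1) = mean n (\<lambda>x. 1)"
    unfolding mean_Suc by (intro mean_cong) simp
  with Suc show ?case by simp
qed

lemma mean_const: "mean n (\<lambda>x. c) = c"
  using mean_cmult[of n c "\<lambda>x. 1"] mean_1 by simp

lemma mean_mono: "(\<And>x. F x \<le> G x) \<Longrightarrow> mean n F \<le> mean n G"
  unfolding mean_def by (intro sum_mono mult_left_mono) (auto simp: wt_nonneg)

lemma info_branches:
  assumes "x \<in> words n"
  shows "info (Suc n) x = info n x - ln (zprob n x)"
    "info (Suc n) (x(n := True)) = info n x - ln (1 - zprob n x)"
  using assms info_cong[OF upd_mem_cyl, of n x True] by (auto simp: info_Suc mfactor_eq words_def)

section \<open>Recursions for the entropy, its fluctuation and the variance\<close>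

definition ent :: "nat \<Rightarrow> real" where "ent n = mean n (info n)"

text \<open>Chain rule: the two branches add the conditional entropy of the new letter given the
  past.\<close>

lemma ent_Suc: "ent (Suc n) = ent n + mean n (\<lambda>x. binent (zprob n x))"
proof -
  have "ent (Suc n) = mean n (\<lambda>x. info n x + binent (zprob n x))"
    unfolding ent_def mean_Suc by (rule mean_cong) (simp add: info_branches binent_def algebra_simps)
  then show ?thesis by (simp add: mean_add ent_def)
qed

lemma ent_increment: "0 \<le> mean n (\<lambda>x. binent (zprob n x))" "mean n (\<lambda>x. binent (zprob n x)) \<le> 1"
  using mean_mono[of "\<lambda>x. 0" "\<lambda>x. binent (zprob n x)" n] mean_mono[of "\<lambda>x. binent (zprob n x)" "\<lambda>x. 1" n]
    binent_bounds zprob_bounds by (auto simp: mean_const)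

lemma ent_mono: "mono ent"
  by (intro mono_iff_le_Suc[THEN iffD2] allI) (use ent_increment in \<open>simp add: ent_Suc\<close>)

lemma ent_Suc_le: "ent (Suc n) \<le> ent n + 1"
  using ent_increment by (simp add: ent_Suc)

definition var :: "nat \<Rightarrow> real" where
  "var n = mean n (\<lambda>x. (info n x - ent n)\<^sup>2)"

text \<open>The part of the fluctuation carried by the event that the last letter is 0. The two states
  carry opposite fluctuations, so a Markov step contracts it by the factor \<open>\<bar>p n - q n\<bar>\<close>.\<close>
definition zfluct :: "nat \<Rightarrow> real" where
  "zfluct n = mean n (\<lambda>x. (info n x - ent n) * of_bool (\<not> prev n x))"

lemma mean_fluct: "mean n (\<lambda>x. info n x - ent n) = 0"
  by (simp add: mean_diff mean_const ent_def)

text \<open>\<open>zprob n x\<close> takes only the values \<open>p n\<close> and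
  \<open>q n\<close>. Since the fluctuation has mean 0, subtracting the constant
  \<open>f (q n)\<close> leaves the part on one state, which is \<open>zfluct\<close>.\<close>

lemma mean_fluct_mult_state:
  "mean n (\<lambda>x. (info n x - ent n) * f (zprob n x)) = (f (p n) - f (q n)) * zfluct n"
proof -
  have "mean n (\<lambda>x. (info n x - ent n) * f (zprob n x)) =
    mean n (\<lambda>x. f (q n) * (info n x - ent n) + (f (p n) - f (q n)) * ((info n x - ent n) * of_bool (\<not> prev n x)))"
    by (rule mean_cong) (simp add: zprob_def algebra_simps)
  also have "\<dots> = (f (p n) - f (q n)) * zfluct n"
    by (simp only: mean_add mean_cmult mean_fluct zfluct_def mult_zero_right add_0)
  finally show ?thesis .
qed

text \<open>The new letter is 0 with probability \<open>zprob n x\<close>. The old fluctuation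
  weighted by it gives \<open>(p n - q n) * zfluct n\<close>; the new contribution
  \<open>t * (- ln t - c)\<close> stays in [-1, 1].\<close>

lemma zfluct_Suc: "\<bar>zfluct (Suc n)\<bar> \<le> \<bar>p n - q n\<bar> * \<bar>zfluct n\<bar> + 1"
proof -
  define c where "c = mean n (\<lambda>x. binent (zprob n x))"
  have c: "0 \<le> c" "c \<le> 1" using ent_increment by (auto simp: c_def)
  have "zfluct (Suc n) = mean n (\<lambda>x. (info n x - ent n) * zprob n x + zprob n x * (- ln (zprob n x) - c))"
    unfolding zfluct_def mean_Suc
  proof (rule mean_cong)
    fix x assume x: "x \<in> words n"
    \<comment> \<open>The indicator kills the branch with new letter 1.\<close>
    then have "\<not> prev (Suc n) x" "prev (Suc n) (x(n := True))" by (auto simp: prev_def words_def)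
    then show "zprob n x * ((info (Suc n) x - ent (Suc n)) * of_bool (\<not> prev (Suc n) x)) +
       (1 - zprob n x) * ((info (Suc n) (x(n := True)) - ent (Suc n)) * of_bool (\<not> prev (Suc n) (x(n := True)))) =
       (info n x - ent n) * zprob n x + zprob n x * (- ln (zprob n x) - c)"
      using x by (simp add: info_branches ent_Suc c_def algebra_simps)
  qed
  also have "\<dots> = (p n - q n) * zfluct n + mean n (\<lambda>x. zprob n x * (- ln (zprob n x) - c))"
    using mean_fluct_mult_state[of n "\<lambda>t. t"] by (simp add: mean_add)
  finally have eq: "zfluct (Suc n) = (p n - q n) * zfluct n + mean n (\<lambda>x. zprob n x * (- ln (zprob n x) - c))" .
  have b: "- 1 \<le> zprob n x * (- ln (zprob n x) - c)" "zprob n x * (- ln (zprob n x) - c) \<le> 1" for x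
  proof -
    let ?t = "zprob n x"
    have "?t * c \<le> 1 * 1" using zprob_bounds[of n x] c by (intro mult_mono) auto
    moreover have "0 \<le> ?t * c" using zprob_bounds[of n x] c by simp
    moreover have "0 \<le> ?t * - ln ?t"
      using zprob_bounds[of n x] neg_ln_nonneg by (intro mult_nonneg_nonneg) auto
    moreover have "?t * - ln ?t \<le> 1/2" using mult_neg_ln_bounds(1) zprob_bounds by blast
    ultimately show "- 1 \<le> ?t * (- ln ?t - c)" "?t * (- ln ?t - c) \<le> 1"
      by (auto simp: right_diff_distrib)
  qed
  have "\<bar>mean n (\<lambda>x. zprob n x * (- ln (zprob n x) - c))\<bar> \<le> 1"
    using mean_mono[of "\<lambda>x. - 1", OF b(1), of n] mean_mono[of _ "\<lambda>x. 1", OF b(2), of n]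
    by (auto simp: mean_const abs_le_iff)
  then show ?thesis unfolding eq abs_mult[symmetric] by linarith
qed

text \<open>Expanding the square, the cross term has conditional mean
  \<open>binent (zprob n x) - c\<close>, so it averages to the entropy difference times
  \<open>zfluct\<close>. The 8 is 2 times the 4 of \<open>binent_diff_le\<close>, and 9 = 4 + 4 + 1
  bounds \<open>K\<close>.\<close>

lemma var_Suc: "var (Suc n) \<le> var n + 8 * (\<bar>zfluct n\<bar> * sqrt (1 - \<bar>p n - q n\<bar>)) + 9"
proof -
  define c where "c = mean n (\<lambda>x. binent (zprob n x))"
  have c: "0 \<le> c" "c \<le> 1" using ent_increment by (auto simp: c_def)
  have ent: "ent (Suc n) = ent n + c" by (simp add: ent_Suc c_def)
  \<comment> \<open>The conditional second moment of the centred increment when the next letter is 0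
    with probability \<open>t\<close>.\<close>
  define K where "K t = t * (ln t)\<^sup>2 + (1 - t) * (ln (1 - t))\<^sup>2 - 2 * c * binent t + c\<^sup>2" for t
  have "var (Suc n) = mean n (\<lambda>x. (info n x - ent n)\<^sup>2 +
      (2 * ((info n x - ent n) * (binent (zprob n x) - c)) + K (zprob n x)))"
    unfolding var_def mean_Suc
    by (rule mean_cong)
      (simp add: info_branches ent K_def binent_def power2_eq_square algebra_simps)
  also have "\<dots> = var n + (2 * ((binent (p n) - binent (q n)) * zfluct n) + mean n (\<lambda>x. K (zprob n x)))"
    using mean_fluct_mult_state[of n "\<lambda>t. binent t - c"] by (simp add: mean_add mean_cmult var_def)
  finally have eq: "var (Suc n) = var n + (2 * ((binent (p n) - binent (q n)) * zfluct n) + mean n (\<lambda>x. K (zprob n x)))" .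
  have "K (zprob n x) \<le> 9" for x
  proof -
    let ?t = "zprob n x"
    have t: "0 \<le> ?t" "?t \<le> 1" "0 \<le> 1 - ?t" "1 - ?t \<le> 1" using zprob_bounds[of n x] by auto
    have "0 \<le> 2 * c * binent ?t" using c binent_bounds(1)[OF t(1,2)] by simp
    moreover have "c\<^sup>2 \<le> 1" using c by (simp add: power_le_one)
    ultimately show ?thesis
      using mult_neg_ln_bounds(4)[OF t(1,2)] mult_neg_ln_bounds(4)[OF t(3,4)] by (simp add: K_def)
  qed
  then have "mean n (\<lambda>x. K (zprob n x)) \<le> 9"
    using mean_mono[of "\<lambda>x. K (zprob n x)" "\<lambda>x. 9" n] by (simp add: mean_const)
  moreover have "(binent (p n) - binent (q n)) * zfluct n \<le> \<bar>binent (p n) - binent (q n)\<bar> * \<bar>zfluct n\<bar>"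
    by (metis abs_ge_self abs_mult)
  moreover have "\<bar>binent (p n) - binent (q n)\<bar> * \<bar>zfluct n\<bar> \<le> 4 * sqrt (1 - \<bar>p n - q n\<bar>) * \<bar>zfluct n\<bar>"
    using p_bounds q_bounds by (intro mult_right_mono binent_diff_le) auto
  ultimately show ?thesis unfolding eq by (simp add: algebra_simps)
qed

lemma zfluct_le: "\<bar>zfluct n\<bar> \<le> real n"
proof (induction n)
  case 0
  then show ?case by (simp add: zfluct_def mean_def words_0 info_def ent_def)
next
  case (Suc n)
  have "\<bar>p n - q n\<bar> \<le> 1" using p_bounds[of n] q_bounds[of n] by auto
  then have "\<bar>p n - q n\<bar> * \<bar>zfluct n\<bar> \<le> 1 * \<bar>zfluct n\<bar>" by (intro mult_right_mono) auto
  then show ?case using zfluct_Suc[of n] Suc by simp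
qed

lemma var_0: "var 0 = 0"
  by (simp add: var_def mean_def words_0 info_def ent_def)

text \<open>Telescoping \<open>\<bar>zfluct\<bar>\<close> controls the sum of \<open>\<bar>zfluct j\<bar> * (1 - \<bar>p j - q j\<bar>)\<close> linearly;
  AM-GM with weight \<open>K\<close> trades the square root in \<open>var_Suc\<close> for this sum.\<close>
lemma var_le:
  assumes K: "0 < K"
  shows "var n \<le> 9 * real n + 4 * (K * real n + (real n)\<^sup>2 / K)"
proof -
  define a where "a j = \<bar>zfluct j\<bar>" for j
  define \<rho> where "\<rho> j = \<bar>p j - q j\<bar>" for j
  have a0: "0 \<le> a j" for j by (simp add: a_def)
  have \<rho>1: "\<rho> j \<le> 1" for j using p_bounds[of j] q_bounds[of j] by (auto simp: \<rho>_def)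
  have amgm: "a j * sqrt (1 - \<rho> j) \<le> (K * (a j * (1 - \<rho> j)) + a j / K) / 2" for j
  proof -
    define u where "u = sqrt (1 - \<rho> j)"
    have uu: "u * u = 1 - \<rho> j" using \<rho>1[of j] by (simp add: u_def)
    have "0 \<le> (K * u - 1)\<^sup>2 / K" using K by simp
    then have "2 * u \<le> K * (u * u) + 1 / K" using K by (simp add: power2_eq_square field_simps)
    from mult_left_mono[OF this a0[of j]] show ?thesis
      unfolding u_def[symmetric] uu by (simp add: algebra_simps)
  qed
  \<comment> \<open>\<open>zfluct_Suc\<close> rearranges to
    \<open>a n * (1 - \<rho> n) \<le> a n - a (Suc n) + 1\<close>; the term \<open>- a n\<close> on
    the right carries the telescoping.\<close>
  have tele: "(\<Sum>j<n. a j * (1 - \<rho> j)) \<le> real n - a n" for n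
  proof (induction n)
    case 0
    show ?case using zfluct_le[of 0] by (simp add: a_def)
  next
    case (Suc n)
    then show ?case using zfluct_Suc[of n] by (simp add: a_def \<rho>_def algebra_simps)
  qed
  have "(\<Sum>j<n. a j) \<le> (\<Sum>j<n. real n)"
  proof (intro sum_mono)
    fix j assume "j \<in> {..<n}"
    then show "a j \<le> real n" using zfluct_le[of j] by (simp add: a_def)
  qed
  then have suma: "(\<Sum>j<n. a j) \<le> (real n)\<^sup>2" by (simp add: power2_eq_square)
  have "var n \<le> 9 * real n + 8 * (\<Sum>j<n. a j * sqrt (1 - \<rho> j))"
  proof (induction n)
    case (Suc n)
    then show ?case using var_Suc[of n] by (simp add: a_def \<rho>_def algebra_simps)
  qed (simp add: var_0)
  also have "(\<Sum>j<n. a j * sqrt (1 - \<rho> j)) \<le> (\<Sum>j<n. (K * (a j * (1 - \<rho> j)) + a j / K) / 2)"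
    by (intro sum_mono amgm)
  also have "\<dots> = (K * (\<Sum>j<n. a j * (1 - \<rho> j)) + (\<Sum>j<n. a j) / K) / 2"
    by (simp add: sum.distrib sum_distrib_left sum_divide_distrib add_divide_distrib)
  also have "\<dots> \<le> (K * real n + (real n)\<^sup>2 / K) / 2"
  proof -
    have "K * (\<Sum>j<n. a j * (1 - \<rho> j)) \<le> K * real n"
      using K tele[of n] a0[of n] by (intro mult_left_mono) auto
    moreover have "(\<Sum>j<n. a j) / K \<le> (real n)\<^sup>2 / K" using suma K by (intro divide_right_mono) auto
    ultimately show ?thesis by - (rule divide_right_mono[OF add_mono], assumption+, simp)
  qed
  finally show ?thesis by (simp add: field_simps)
qed

text \<open>For \<open>n = k ^ 4\<close> the weight \<open>K = k\<^sup>2\<close> balances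
  \<open>K * n\<close> against \<open>n\<^sup>2 / K\<close>; both become k^6, and 17 = 9 + 4 +
  4.\<close>

lemma var_fourth_power: "var (k ^ 4) \<le> 17 * real k ^ 6"
proof (cases "k = 0")
  case False
  have "var (k ^ 4) \<le> 9 * real k ^ 4 + 4 * ((real k)\<^sup>2 * real k ^ 4 + (real k ^ 4)\<^sup>2 / (real k)\<^sup>2)"
    using var_le[of "(real k)\<^sup>2" "k ^ 4"] False by simp
  also have "(real k ^ 4)\<^sup>2 / (real k)\<^sup>2 = real k ^ 6"
    using False by (simp add: power_mult[symmetric] power_diff[symmetric])
  also have "(real k)\<^sup>2 * real k ^ 4 = real k ^ 6" by (simp flip: power_add)
  also have "real k ^ 4 \<le> real k ^ 6" using False by (intro power_increasing) auto
  finally show ?thesis by simp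
qed (simp add: var_0)

end

section \<open>Almost sure convergence and dimensions\<close>

text \<open>Both sequences are monotone, and \<open>(k + 1) ^ 4 - k ^ 4\<close> is negligible against \<open>k ^ 4\<close>.\<close>
lemma tendsto_interpolate_fourth_powers:
  fixes S e :: "nat \<Rightarrow> real"
  assumes S: "mono S" and e: "mono e" "\<And>n. e (Suc n) \<le> e n + 1"
    and lim: "(\<lambda>k. (S (k ^ 4) - e (k ^ 4)) / real k ^ 4) \<longlonglongrightarrow> 0"
  shows "(\<lambda>n. (S n - e n) / real n) \<longlonglongrightarrow> 0"
proof -
  have e_le: "e (n + m) \<le> e n + real m" for n m
  proof (induction m)
    case (Suc m)
    then show ?case using e(2)[of "n + m"] by simp
  qed simp
  define D where "D k = \<bar>(S (k ^ 4) - e (k ^ 4)) / real k ^ 4\<bar>" for k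
  \<comment> \<open>For \<open>n\<close> between k^4 and (k + 1)^4 the error is bounded by the
    errors at both ends and the growth of \<open>e\<close> across the block. The 16 is 2^4: (k +
    1)^4 is at most 16 k^4 once \<open>1 \<le> k\<close>.\<close>
  define g where "g k = D k + 16 * D (Suc k) + ((real k + 1) ^ 4 - real k ^ 4) / real k ^ 4" for k
  have D: "D \<longlonglongrightarrow> 0" unfolding D_def using lim by (rule tendsto_rabs_zero)
  have "(\<lambda>k. ((real k + 1) ^ 4 - real k ^ 4) / real k ^ 4) \<longlonglongrightarrow> 0" by real_asymp
  then have "g \<longlonglongrightarrow> 0 + 16 * 0 + 0"
    unfolding g_def by (intro tendsto_add tendsto_mult tendsto_const D LIMSEQ_Suc[OF D])
  then have g: "g \<longlonglongrightarrow> 0" by simp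
  define r where "r n = nat \<lfloor>root 4 (real n)\<rfloor>" for n
  have r_lim: "filterlim r at_top sequentially"
    unfolding r_def by real_asymp
  have bound: "\<bar>(S n - e n) / real n\<bar> \<le> g (r n)" if n: "n \<ge> 1" for n
  proof -
    define k where "k = r n"
    have root: "1 \<le> root 4 (real n)" using n by simp
    have k1: "1 \<le> k" using root unfolding k_def r_def by linarith
    have k_le: "real k \<le> root 4 (real n)" and k_gt: "root 4 (real n) < real k + 1"
      using root unfolding k_def r_def by linarith+
    have "real k ^ 4 \<le> root 4 (real n) ^ 4" using k_le by (intro power_mono) auto
    then have "real (k ^ 4) \<le> real n" by (simp add: real_root_pow_pos2)
    then have kn: "k ^ 4 \<le> n" by (simp only: of_nat_le_iff)
    have "root 4 (real n) ^ 4 < (real k + 1) ^ 4" using k_gt root by (intro power_strict_mono) auto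
    then have "real n < real (Suc k ^ 4)" by (simp add: real_root_pow_pos2 add.commute)
    then have nk: "n \<le> Suc k ^ 4" by (simp only: of_nat_less_iff less_imp_le)
    define d where "d = (real k + 1) ^ 4 - real k ^ 4"
    have gap: "real (Suc k ^ 4 - k ^ 4) = d"
      using kn nk by (simp add: d_def of_nat_diff add.commute)
    have "e (Suc k ^ 4) \<le> e (k ^ 4) + d"
      using e_le[of "k ^ 4" "Suc k ^ 4 - k ^ 4"] kn nk gap by simp
    \<comment> \<open>Upwards, \<open>S n\<close> is compared with the right end; downwards, with
      the left end. In both cases \<open>e\<close> changes by at most \<open>d\<close>.\<close>
    moreover have "e (k ^ 4) \<le> e n" "e n \<le> e (Suc k ^ 4)" "S (k ^ 4) \<le> S n" "S n \<le> S (Suc k ^ 4)"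
      using kn nk S e(1) by (auto dest: monoD)
    ultimately have abs: "\<bar>S n - e n\<bar> \<le> \<bar>S (k ^ 4) - e (k ^ 4)\<bar> + \<bar>S (Suc k ^ 4) - e (Suc k ^ 4)\<bar> + d"
      by linarith
    have kpos: "0 < real k ^ 4" using k1 by simp
    have "\<bar>(S n - e n) / real n\<bar> \<le> \<bar>S n - e n\<bar> / real k ^ 4"
      using kn kpos n by (auto simp: abs_divide intro!: divide_left_mono simp flip: of_nat_power)
    also have "\<dots> \<le> (\<bar>S (k ^ 4) - e (k ^ 4)\<bar> + \<bar>S (Suc k ^ 4) - e (Suc k ^ 4)\<bar> + d) / real k ^ 4"
      using abs kpos by (intro divide_right_mono) auto
    also have "\<dots> = D k + \<bar>S (Suc k ^ 4) - e (Suc k ^ 4)\<bar> / real k ^ 4 + d / real k ^ 4"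
      by (simp add: D_def abs_divide add_divide_distrib)
    also have "\<bar>S (Suc k ^ 4) - e (Suc k ^ 4)\<bar> / real k ^ 4 \<le> 16 * D (Suc k)"
    proof -
      have "real (Suc k) ^ 4 \<le> (2 * real k) ^ 4" using k1 by (intro power_mono) auto
      then have "real (Suc k) ^ 4 \<le> 16 * real k ^ 4" by (simp add: power_mult_distrib)
      then have "\<bar>S (Suc k ^ 4) - e (Suc k ^ 4)\<bar> * real (Suc k) ^ 4 \<le> \<bar>S (Suc k ^ 4) - e (Suc k ^ 4)\<bar> * (16 * real k ^ 4)"
        by (intro mult_left_mono) auto
      moreover have "0 < real (Suc k) ^ 4" by simp
      ultimately show ?thesis using kpos unfolding D_def abs_divide
        by (simp add: divide_simps del: of_nat_Suc power_Suc)
    qed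
    finally show ?thesis by (simp add: g_def k_def d_def)
  qed
  have "(\<lambda>n. g (r n)) \<longlonglongrightarrow> 0" using filterlim_compose[OF g r_lim] .
  then show ?thesis
    by (rule Lim_null_comparison[rotated]) (use bound in \<open>auto simp: eventually_sequentially\<close>)
qed

section \<open>Law of large numbers for the Markov measure\<close>

locale markov_cantor = markov_params + cantor_prob_space +
  assumes emeasure_cyl: "emeasure M (cyl n x) = ennreal (\<Prod>i<n. mfactor p q x i)"
begin

lemma measure_cyl: "measure M (cyl n x) = wt n x"
  using emeasure_cyl[of n x] wt_nonneg[of n x] by (simp add: measure_def wt_def)

text \<open>Links \<open>mean\<close> to the measure: \<open>F\<close> is a simple function,
  constant on the cylinders of words of length \<open>n\<close>.\<close>

lemma nn_integral_cylindrical: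
  assumes F: "\<And>x y. y \<in> cyl n x \<Longrightarrow> F y = F x" "\<And>x. 0 \<le> F x"
  shows "(\<lambda>x. ennreal (F x)) \<in> borel_measurable M" "(\<integral>\<^sup>+x. ennreal (F x) \<partial>M) = ennreal (mean n F)"
proof -
  have F_eq: "ennreal (F x) = (\<Sum>y\<in>words n. ennreal (F y) * indicator (cyl n y) x)" for x
  proof -
    let ?y = "\<lambda>i. i < n \<and> x i"
    have "(\<Sum>y\<in>words n. ennreal (F y) * indicator (cyl n y) x) = (\<Sum>y\<in>{?y}. ennreal (F y) * indicator (cyl n y) x)"
    proof (rule sum.mono_neutral_right)
      show "\<forall>y\<in>words n - {?y}. ennreal (F y) * indicator (cyl n y) x = 0"
      proof
        fix y assume y: "y \<in> words n - {?y}"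
        have "x \<notin> cyl n y"
        proof
          assume "x \<in> cyl n y"
          then have "?y \<in> cyl n y" by (auto simp: cyl_def)
          then show False using y mem_words_cyl_eq[OF truncate_mem_words] by blast
        qed
        then show "ennreal (F y) * indicator (cyl n y) x = 0" by simp
      qed
    qed (auto simp: finite_words truncate_mem_words)
    also have "\<dots> = ennreal (F x)" using truncate_mem_cyl(1)[of x n] F(1) by simp
    finally show ?thesis by simp
  qed
  have fun_eq: "(\<lambda>x. ennreal (F x)) = (\<lambda>x. \<Sum>y\<in>words n. ennreal (F y) * indicator (cyl n y) x)"
    by (rule ext) (rule F_eq)
  show "(\<lambda>x. ennreal (F x)) \<in> borel_measurable M"
    by (subst fun_eq) measurable
  have "(\<integral>\<^sup>+x. ennreal (F x) \<partial>M) = (\<Sum>y\<in>words n. ennreal (F y) * emeasure M (cyl n y))"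
    by (subst fun_eq, subst nn_integral_sum) (auto simp: nn_integral_cmult_indicator)
  also have "\<dots> = (\<Sum>y\<in>words n. ennreal (wt n y * F y))"
    by (simp add: emeasure_eq_measure measure_cyl ennreal_mult wt_nonneg F mult.commute)
  also have "\<dots> = ennreal (mean n F)"
    unfolding mean_def by (intro sum_ennreal) (simp add: wt_nonneg F)
  finally show "(\<integral>\<^sup>+x. ennreal (F x) \<partial>M) = ennreal (mean n F)" .
qed

text \<open>Words of weight 0 contribute 0 to the mean of their indicator. Off this null set
  \<open>info\<close> is minus the logarithm of the mass.\<close>

lemma AE_wt_pos: "AE x in M. \<forall>n. 0 < wt n x"
  unfolding AE_all_countable
proof
  fix n
  let ?F = "\<lambda>x. of_bool (wt n x = 0) :: real"
  have c: "?F y = ?F x" if "y \<in> cyl n x" for x y using wt_cong[OF that] by simp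
  have "mean n ?F = 0" unfolding mean_def by (intro sum.neutral) auto
  then have "(\<integral>\<^sup>+x. ennreal (?F x) \<partial>M) = 0"
    using nn_integral_cylindrical(2)[of n ?F, OF c] by simp
  then have "AE x in M. ennreal (?F x) = 0"
    using nn_integral_0_iff_AE[OF nn_integral_cylindrical(1)[of n ?F, OF c]] by simp
  then show "AE x in M. 0 < wt n x"
    by eventually_elim (use wt_nonneg in \<open>auto simp: less_le split: if_splits\<close>)
qed

text \<open>The variance bound makes the expected sum of \<open>Z k\<close> finite, so almost surely
  the sum is finite and its terms tend to 0. Monotone interpolation passes from fourth powers to all
  \<open>n\<close>.\<close>

lemma AE_info_tendsto: "AE x in M. (\<lambda>n. (info n x - ent n) / real n) \<longlonglongrightarrow> 0"
proof -
  define Z where "Z k x = ((info (k ^ 4) x - ent (k ^ 4)) / real k ^ 4)\<^sup>2" for k x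
  have Z_cong: "Z k y = Z k x" if "y \<in> cyl (k ^ 4) x" for k x y
    using info_cong[OF that] by (simp add: Z_def)
  have meas [measurable]: "(\<lambda>x. ennreal (Z k x)) \<in> borel_measurable M" for k
    by (rule nn_integral_cylindrical[OF Z_cong]) (simp_all add: Z_def)
  have int: "(\<integral>\<^sup>+x. ennreal (Z k x) \<partial>M) \<le> ennreal (17 * (1 / (real k)\<^sup>2))" for k
  proof -
    have "(\<integral>\<^sup>+x. ennreal (Z k x) \<partial>M) = ennreal (mean (k ^ 4) (Z k))"
      by (rule nn_integral_cylindrical[OF Z_cong]) (simp_all add: Z_def)
    also have "mean (k ^ 4) (Z k) = var (k ^ 4) / real k ^ 8"
      using mean_cmult[of "k ^ 4" "1 / real k ^ 8" "\<lambda>x. (info (k ^ 4) x - ent (k ^ 4))\<^sup>2"]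
      by (simp add: Z_def[abs_def] var_def power_divide flip: power_mult)
    also have "\<dots> \<le> 17 * real k ^ 6 / real k ^ 8"
      by (intro divide_right_mono var_fourth_power) auto
    \<comment> \<open>At \<open>k = 0\<close> both sides are 0 by the convention for division by
      0.\<close>
    also have "\<dots> = 17 * (1 / (real k)\<^sup>2)"
      by (cases "k = 0") (auto simp: field_simps simp flip: power_add)
    finally show ?thesis by (auto intro: ennreal_leI)
  qed
  have "summable (\<lambda>k. 17 * (1 / (real k)\<^sup>2))"
    by (intro summable_mult) (use inverse_power_summable[of 2, where 'a = real] in \<open>simp add: inverse_eq_divide\<close>)
  then have fin: "(\<Sum>k. ennreal (17 * (1 / (real k)\<^sup>2))) \<noteq> \<infinity>"
    by (subst suminf_ennreal2) auto
  have "(\<integral>\<^sup>+x. (\<Sum>k. ennreal (Z k x)) \<partial>M) = (\<Sum>k. \<integral>\<^sup>+x. ennreal (Z k x) \<partial>M)"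
    by (rule nn_integral_suminf) (rule meas)
  also have "\<dots> \<le> (\<Sum>k. ennreal (17 * (1 / (real k)\<^sup>2)))"
    by (intro suminf_le int) auto
  finally have "(\<integral>\<^sup>+x. (\<Sum>k. ennreal (Z k x)) \<partial>M) \<noteq> \<infinity>"
    using fin by (auto simp: top_unique)
  then have "AE x in M. (\<Sum>k. ennreal (Z k x)) \<noteq> \<infinity>"
    by (rule nn_integral_PInf_AE[rotated]) measurable
  then show ?thesis
  proof eventually_elim
    case (elim x)
    then have "summable (\<lambda>k. Z k x)"
      by (intro summable_suminf_not_top) (auto simp: Z_def)
    then have "(\<lambda>k. Z k x) \<longlonglongrightarrow> 0" by (rule summable_LIMSEQ_zero)
    then have "(\<lambda>k. sqrt (Z k x)) \<longlonglongrightarrow> sqrt 0" by (rule tendsto_real_sqrt)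
    then have "(\<lambda>k. (info (k ^ 4) x - ent (k ^ 4)) / real k ^ 4) \<longlonglongrightarrow> 0"
      unfolding Z_def real_sqrt_abs real_sqrt_zero by (rule tendsto_rabs_zero_cancel)
    then show ?case
      by (intro tendsto_interpolate_fourth_powers info_mono ent_mono ent_Suc_le)
  qed
qed

text \<open>Words of weight 0 count as 0 on both sides; for the others the logarithm of the product
  splits into the sum \<open>info\<close>.\<close>

lemma entropy_n_eq: "entropy_n M n = ent n"
proof -
  have "entropy_n M n = - (\<Sum>x\<in>words n. xlogx (wt n x))"
    unfolding entropy_n_def gen_eq_words by (simp add: sum.reindex inj_on_cyl_words measure_cyl)
  also have "\<dots> = (\<Sum>x\<in>words n. wt n x * info n x)"
    unfolding sum_negf[symmetric]
  proof (rule sum.cong)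
    fix x
    show "- xlogx (wt n x) = wt n x * info n x"
    proof (cases "wt n x = 0")
      case False
      then have "\<forall>i<n. mfactor p q x i \<noteq> 0" by (auto simp: wt_def)
      then have "ln (wt n x) = (\<Sum>i<n. ln (mfactor p q x i))"
        unfolding wt_def using mfactor_bounds[of x] by (intro ln_prod) (auto simp: less_le)
      then show ?thesis using False by (simp add: xlogx_def info_def sum_negf)
    qed (simp add: xlogx_def)
  qed simp
  finally show ?thesis by (simp add: ent_def mean_def)
qed

text \<open>The law of large numbers in exponential form, via
  \<open>wt n x = exp (- info n x)\<close>; the factor \<open>ln 2\<close> changes the base to
  2.\<close>

lemma AE_local_dimension:
  "AE x in M. \<forall>\<epsilon>>0. \<forall>\<^sub>F n in sequentially.
     2 powr (- (real n * (entropy_n M n / (real n * ln 2) + \<epsilon>))) \<le> measure M (cyl n x) \<and>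
     measure M (cyl n x) \<le> 2 powr (- (real n * (entropy_n M n / (real n * ln 2) - \<epsilon>)))"
  using AE_info_tendsto AE_wt_pos
proof eventually_elim
  case (elim x)
  show ?case
  proof (intro allI impI)
    fix \<epsilon> :: real assume \<epsilon>: "0 < \<epsilon>"
    then have "\<forall>\<^sub>F n in sequentially. dist ((info n x - ent n) / real n) 0 < \<epsilon> * ln 2"
      using elim(1) by (intro tendstoD) auto
    then show "\<forall>\<^sub>F n in sequentially.
       2 powr (- (real n * (entropy_n M n / (real n * ln 2) + \<epsilon>))) \<le> measure M (cyl n x) \<and>
       measure M (cyl n x) \<le> 2 powr (- (real n * (entropy_n M n / (real n * ln 2) - \<epsilon>)))"
      using eventually_gt_at_top[of 0]
    proof eventually_elim
      case (elim n)
      have "wt n x \<noteq> 0"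
        using \<open>\<forall>n. 0 < wt n x\<close>[rule_format, of n] by simp
      then have pos: "\<forall>i<n. mfactor p q x i \<noteq> 0" by (auto simp: wt_def)
      have "ln (wt n x) = (\<Sum>i<n. ln (mfactor p q x i))"
        unfolding wt_def using mfactor_bounds[of x] pos by (intro ln_prod) (auto simp: less_le)
      then have "ln (wt n x) = - info n x"
        by (simp add: info_def sum_negf)
      then have "wt n x = exp (- info n x)"
        using exp_ln[of "wt n x"] \<open>\<forall>n. 0 < wt n x\<close> by simp
      moreover have "\<bar>info n x - ent n\<bar> \<le> \<epsilon> * ln 2 * real n"
        using elim by (simp add: abs_divide pos_divide_less_eq)
      ultimately show ?case
        using elim by (simp add: measure_cyl entropy_n_eq powr_def algebra_simps abs_le_iff)
    qed
  qed
qed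

section \<open>Local dimensions against the lower and upper entropy rates\<close>

lemma entropy_rate_nonneg: "0 \<le> ereal (entropy_n M n / (real n * ln 2))"
proof -
  have "ent 0 \<le> ent n" using ent_mono by (simp add: monoD)
  then show ?thesis by (simp add: entropy_n_eq ent_def mean_def words_0 info_def)
qed

lemma h_lower_nonneg: "0 \<le> h_lower M"
  unfolding h_lower_def by (intro Liminf_bounded always_eventually allI entropy_rate_nonneg)

lemma h_upper_nonneg: "0 \<le> h_upper M"
  unfolding h_upper_def using h_lower_nonneg
  by (rule order_trans) (simp add: h_lower_def Liminf_le_Limsup)

text \<open>With \<open>t\<close> strictly between \<open>s\<close> and the entropy rate, the gap
  between \<open>s\<close> and \<open>t\<close> serves as \<open>\<epsilon>\<close>. In the last two
  claims \<open>s\<close> is quantified inside the almost-sure statement, so that one full set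
  serves all exponents.\<close>

lemma AE_local_dimension_bounds:
  shows "ereal s < h_lower M \<Longrightarrow>
      AE x in M. \<forall>\<^sub>F n in sequentially. measure M (cyl n x) \<le> 2 powr (- (real n * s))"
    and "ereal s < h_upper M \<Longrightarrow>
      AE x in M. \<exists>\<^sub>F n in sequentially. measure M (cyl n x) \<le> 2 powr (- (real n * s))"
    and "AE x in M. \<forall>s. h_lower M < ereal s \<longrightarrow>
      (\<exists>\<^sub>F n in sequentially. 2 powr (- (real n * s)) \<le> measure M (cyl n x))"
    and "AE x in M. \<forall>s. h_upper M < ereal s \<longrightarrow>
      (\<forall>\<^sub>F n in sequentially. 2 powr (- (real n * s)) \<le> measure M (cyl n x))"
proof -
  define h where "h n = entropy_n M n / (real n * ln 2)" for n
  have ae: "AE x in M. \<forall>\<epsilon>>0. \<forall>\<^sub>F n in sequentially.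
     2 powr (- (real n * (h n + \<epsilon>))) \<le> measure M (cyl n x) \<and>
     measure M (cyl n x) \<le> 2 powr (- (real n * (h n - \<epsilon>)))"
    using AE_local_dimension by (simp add: h_def)
  have up: "measure M (cyl n x) \<le> 2 powr (- (real n * s))"
    if "measure M (cyl n x) \<le> 2 powr (- (real n * (h n - (t - s))))" "t < h n" for n x s t
  proof -
    have "real n * s \<le> real n * (h n - (t - s))" using that by (intro mult_left_mono) auto
    then have "2 powr (- (real n * (h n - (t - s)))) \<le> 2 powr (- (real n * s))" by simp
    with that show ?thesis by linarith
  qed
  have lo: "2 powr (- (real n * s)) \<le> measure M (cyl n x)"
    if "2 powr (- (real n * (h n + (s - t)))) \<le> measure M (cyl n x)" "h n < t" for n x s t
  proof -
    have "real n * (h n + (s - t)) \<le> real n * s" using that by (intro mult_left_mono) auto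
    then have "2 powr (- (real n * s)) \<le> 2 powr (- (real n * (h n + (s - t))))" by simp
    with that show ?thesis by linarith
  qed
  show "AE x in M. \<forall>\<^sub>F n in sequentially. measure M (cyl n x) \<le> 2 powr (- (real n * s))"
    if s: "ereal s < h_lower M"
  proof -
    obtain t where t: "ereal s < ereal t" "ereal t < h_lower M" using ereal_dense2[OF s] by blast
    have ev: "\<forall>\<^sub>F n in sequentially. t < h n"
      using less_LiminfD[OF t(2)[unfolded h_lower_def]] by (simp add: h_def)
    show ?thesis using ae
    proof eventually_elim
      case (elim x)
      then have "\<forall>\<^sub>F n in sequentially. measure M (cyl n x) \<le> 2 powr (- (real n * (h n - (t - s))))"
        using t(1) by (auto elim!: allE[of _ "t - s"] eventually_mono)
      with ev show ?case by eventually_elim (rule up)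
    qed
  qed
  show "AE x in M. \<exists>\<^sub>F n in sequentially. measure M (cyl n x) \<le> 2 powr (- (real n * s))"
    if s: "ereal s < h_upper M"
  proof -
    obtain t where t: "ereal s < ereal t" "ereal t < h_upper M" using ereal_dense2[OF s] by blast
    have fr: "\<exists>\<^sub>F n in sequentially. t < h n"
    proof (rule ccontr)
      assume "\<not> ?thesis"
      then have "\<forall>\<^sub>F n in sequentially. ereal (h n) \<le> ereal t"
        by (simp add: not_frequently not_less)
      from Limsup_bounded[OF this] t(2) show False by (simp add: h_upper_def h_def)
    qed
    show ?thesis using ae
    proof eventually_elim
      case (elim x)
      then have "\<forall>\<^sub>F n in sequentially. measure M (cyl n x) \<le> 2 powr (- (real n * (h n - (t - s))))"
        using t(1) by (auto elim!: allE[of _ "t - s"] eventually_mono)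
      from frequently_eventually_conj[OF fr this] show ?case by (rule frequently_elim1) (blast intro: up)
    qed
  qed
  show "AE x in M. \<forall>s. h_lower M < ereal s \<longrightarrow>
      (\<exists>\<^sub>F n in sequentially. 2 powr (- (real n * s)) \<le> measure M (cyl n x))"
    using ae
  proof eventually_elim
    case (elim x)
    show ?case
    proof (intro allI impI)
      fix s assume s: "h_lower M < ereal s"
      obtain t where t: "h_lower M < ereal t" "ereal t < ereal s" using ereal_dense2[OF s] by blast
      have fr: "\<exists>\<^sub>F n in sequentially. h n < t"
      proof (rule ccontr)
        assume "\<not> ?thesis"
        then have "\<forall>\<^sub>F n in sequentially. ereal t \<le> ereal (h n)"
          by (simp add: not_frequently not_less)
        from Liminf_bounded[OF this] t(1) show False by (simp add: h_lower_def h_def)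
      qed
      have "\<forall>\<^sub>F n in sequentially. 2 powr (- (real n * (h n + (s - t)))) \<le> measure M (cyl n x)"
        using elim t(2) by (auto elim!: allE[of _ "s - t"] eventually_mono)
      from frequently_eventually_conj[OF fr this]
      show "\<exists>\<^sub>F n in sequentially. 2 powr (- (real n * s)) \<le> measure M (cyl n x)"
        by (rule frequently_elim1) (blast intro: lo)
    qed
  qed
  show "AE x in M. \<forall>s. h_upper M < ereal s \<longrightarrow>
      (\<forall>\<^sub>F n in sequentially. 2 powr (- (real n * s)) \<le> measure M (cyl n x))"
    using ae
  proof eventually_elim
    case (elim x)
    show ?case
    proof (intro allI impI)
      fix s assume s: "h_upper M < ereal s"
      obtain t where t: "h_upper M < ereal t" "ereal t < ereal s" using ereal_dense2[OF s] by blast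
      have ev: "\<forall>\<^sub>F n in sequentially. h n < t"
        using Limsup_lessD[OF t(1)[unfolded h_upper_def]] by (simp add: h_def)
      have "\<forall>\<^sub>F n in sequentially. 2 powr (- (real n * (h n + (s - t)))) \<le> measure M (cyl n x)"
        using elim t(2) by (auto elim!: allE[of _ "s - t"] eventually_mono)
      with ev show "\<forall>\<^sub>F n in sequentially. 2 powr (- (real n * s)) \<le> measure M (cyl n x)"
        by eventually_elim (rule lo)
    qed
  qed
qed

section \<open>Dimensions of the measure\<close>

lemma AE_obtain_full_set:
  assumes "AE x in M. P x"
  obtains E where "E \<in> sets M" "emeasure M (UNIV - E) = 0" "\<forall>x\<in>E. P x"
proof -
  obtain N where N: "{x \<in> space M. \<not> P x} \<subseteq> N" "emeasure M N = 0" "N \<in> sets M"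
    using AE_E[OF assms] by metis
  have "UNIV - N \<in> sets M" using sets.compl_sets[OF N(3)] by simp
  moreover have "UNIV - (UNIV - N) = N" by auto
  ultimately show thesis using that[of "UNIV - N"] N by auto
qed

lemma h_lower_le_hdim:
  assumes "E \<in> sets M" "emeasure M E > 0" shows "h_lower M \<le> hdim E"
  unfolding hdim_def
proof (rule Inf_greatest, clarify)
  fix s :: real assume s: "0 \<le> s" "hausdorff_measure s E = 0"
  show "h_lower M \<le> ereal s"
  proof (rule ccontr)
    assume "\<not> ?thesis"
    \<comment> \<open>\<open>hausdorff_measure_pos\<close> asks for a local exponent strictly above
      \<open>s\<close>, hence the intermediate \<open>t\<close>.\<close>
    then obtain t where t: "ereal s < ereal t" "ereal t < h_lower M"
      using ereal_dense2[of "ereal s" "h_lower M"] by (auto simp: not_le)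
    show False
      using hausdorff_measure_pos[OF assms s(1) _ AE_local_dimension_bounds(1)[OF t(2)]] t(1) s(2) by simp
  qed
qed

lemma h_upper_le_pdim:
  assumes "E \<in> sets M" "emeasure M E > 0" shows "h_upper M \<le> pdim E"
  unfolding pdim_def
proof (rule Inf_greatest, clarify)
  fix s :: real assume s: "0 \<le> s" "packing_measure s E = 0"
  show "h_upper M \<le> ereal s"
  proof (rule ccontr)
    assume "\<not> ?thesis"
    then have "ereal s < h_upper M" by simp
    from packing_measure_pos[OF assms s(1) AE_local_dimension_bounds(2)[OF this]] s(2)
    show False by simp
  qed
qed

text \<open>On one full set all exponents above the lower rate are attained infinitely often. Two
  values \<open>s < t\<close> below a given \<open>z\<close> provide the strict gap that
  \<open>hausdorff_measure_eq_0\<close> uses.\<close>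

lemma full_set_hdim_le:
  obtains E where "E \<in> sets M" "emeasure M (UNIV - E) = 0" "hdim E \<le> h_lower M"
proof -
  obtain E where E: "E \<in> sets M" "emeasure M (UNIV - E) = 0"
    "\<forall>x\<in>E. \<forall>s. h_lower M < ereal s \<longrightarrow>
      (\<exists>\<^sub>F n in sequentially. 2 powr (- (real n * s)) \<le> measure M (cyl n x))"
    using AE_obtain_full_set[OF AE_local_dimension_bounds(3)] .
  have "hdim E \<le> h_lower M"
  proof (rule dense_ge)
    fix z assume z: "h_lower M < z"
    obtain t where t: "h_lower M < ereal t" "ereal t < z" using ereal_dense2[OF z] by blast
    obtain s where s: "h_lower M < ereal s" "ereal s < ereal t" using ereal_dense2[OF t(1)] by blast
    have "0 < ereal t" using h_lower_nonneg t(1) by (rule le_less_trans)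
    then have t0: "0 \<le> t" by simp
    have "hausdorff_measure t E = 0"
      by (rule hausdorff_measure_eq_0[of t s]) (use t0 s E(3) in auto)
    then have "hdim E \<le> ereal t" unfolding hdim_def using t0 by (intro Inf_lower) auto
    with t(2) show "hdim E \<le> z" by simp
  qed
  with E that show thesis by blast
qed

lemma full_set_pdim_le:
  obtains E where "E \<in> sets M" "emeasure M (UNIV - E) = 0" "pdim E \<le> h_upper M"
proof -
  obtain E where E: "E \<in> sets M" "emeasure M (UNIV - E) = 0"
    "\<forall>x\<in>E. \<forall>s. h_upper M < ereal s \<longrightarrow>
      (\<forall>\<^sub>F n in sequentially. 2 powr (- (real n * s)) \<le> measure M (cyl n x))"
    using AE_obtain_full_set[OF AE_local_dimension_bounds(4)] .
  have "pdim E \<le> h_upper M"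
  proof (rule dense_ge)
    fix z assume z: "h_upper M < z"
    obtain t where t: "h_upper M < ereal t" "ereal t < z" using ereal_dense2[OF z] by blast
    obtain s where s: "h_upper M < ereal s" "ereal s < ereal t" using ereal_dense2[OF t(1)] by blast
    have "0 < ereal t" using h_upper_nonneg t(1) by (rule le_less_trans)
    then have t0: "0 \<le> t" by simp
    have "packing_measure t E = 0"
      by (rule packing_measure_eq_0[of t s]) (use t0 s E(3) in auto)
    then have "pdim E \<le> ereal t" unfolding pdim_def using t0 by (intro Inf_lower) auto
    with t(2) show "pdim E \<le> z" by simp
  qed
  with E that show thesis by blast
qed

lemma emeasure_full_pos:
  assumes "E \<in> sets M" "emeasure M (UNIV - E) = 0" shows "emeasure M E > 0"
proof -
  have "emeasure M (UNIV - E) = 1 - emeasure M E"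
    using emeasure_compl[OF assms(1)] emeasure_space_1 by simp
  with assms(2) show ?thesis by (auto simp: zero_less_iff_neq_zero)
qed

text \<open>The cycle \<open>h_lower M \<le> dim_lower M \<le> dim_upper M \<le> hdim E \<le>
  h_lower M\<close> for a suitable full set \<open>E\<close>.\<close>

lemma dim_eq_h_lower: "dim_lower M = h_lower M" "dim_upper M = h_lower M"
proof -
  have 1: "h_lower M \<le> dim_lower M"
    unfolding dim_lower_def by (rule Inf_greatest) (auto intro: h_lower_le_hdim)
  have 2: "dim_lower M \<le> dim_upper M"
    unfolding dim_lower_def dim_upper_def by (rule Inf_superset_mono) (auto intro: emeasure_full_pos)
  obtain E where E: "E \<in> sets M" "emeasure M (UNIV - E) = 0" "hdim E \<le> h_lower M"
    using full_set_hdim_le .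
  have "dim_upper M \<le> hdim E"
    unfolding dim_upper_def using E by (intro Inf_lower) auto
  with 1 2 E(3) show "dim_lower M = h_lower M" "dim_upper M = h_lower M" by auto
qed

lemma Dim_eq_h_upper: "Dim_lower M = h_upper M" "Dim_upper M = h_upper M"
proof -
  have 1: "h_upper M \<le> Dim_lower M"
    unfolding Dim_lower_def by (rule Inf_greatest) (auto intro: h_upper_le_pdim)
  have 2: "Dim_lower M \<le> Dim_upper M"
    unfolding Dim_lower_def Dim_upper_def by (rule Inf_superset_mono) (auto intro: emeasure_full_pos)
  obtain E where E: "E \<in> sets M" "emeasure M (UNIV - E) = 0" "pdim E \<le> h_upper M"
    using full_set_pdim_le .
  have "Dim_upper M \<le> pdim E"
    unfolding Dim_upper_def using E by (intro Inf_lower) auto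
  with 1 2 E(3) show "Dim_lower M = h_upper M" "Dim_upper M = h_upper M" by auto
qed

end

theorem theorem1:
  fixes p q :: "nat \<Rightarrow> real" and \<mu> :: "cpt measure"
  assumes "\<And>n. 0 \<le> p n \<and> p n \<le> 1"
    and "\<And>n. 0 \<le> q n \<and> q n \<le> 1"
    and "space \<mu> = UNIV"
    and "sets \<mu> = sigma_sets UNIV (\<Union>n. gen n)"
    and "\<And>n x. emeasure \<mu> (cyl n x) = ennreal (\<Prod>i<n. mfactor p q x i)"
  shows "dim_lower \<mu> = dim_upper \<mu> \<and> dim_upper \<mu> = h_lower \<mu> \<and>
         Dim_lower \<mu> = Dim_upper \<mu> \<and> Dim_upper \<mu> = h_upper \<mu>"
proof -
  \<comment> \<open>At \<open>n = 0\<close> the mass formula gives the whole space the empty product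
    1.\<close>
  interpret prob_space \<mu>
    by (rule prob_spaceI) (use assms(3) assms(5)[of 0] in simp)
  interpret markov_cantor p q \<mu>
  proof
    show "cyl n x \<in> sets \<mu>" for n x
      unfolding assms(4) by (intro sigma_sets.Basic) (auto simp: gen_def)
    show "0 \<le> p n" "p n \<le> 1" "0 \<le> q n" "q n \<le> 1" for n
      using assms(1)[of n] assms(2)[of n] by simp_all
    show "space \<mu> = UNIV" by (rule assms(3))
    show "emeasure \<mu> (cyl n x) = ennreal (\<Prod>i<n. mfactor p q x i)" for n x by (rule assms(5))
  qed
  show ?thesis using dim_eq_h_lower Dim_eq_h_upper by simp
qed

end
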